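(* Let $\mathcal{P}, \mathcal{Q} \subset \mathbb{R}^{n}$ be rational polytopes such that $\mathcal{P}\oplus\mathcal{Q}$ is a free sum. If either $\mathcal{P}^\vee$ or $\mathcal{Q}^\vee$ is a lattice polyhedron, then $$\operatorname{Ehr}_{\mathcal{P}\oplus\mathcal{Q}}(t) = (1-t)\operatorname{Ehr}_{\mathcal{P}}(t)\operatorname{Ehr}_{\mathcal{Q}}(t) \qquad (\ast)$$ and hence $$\delta_{\mathcal{P}\oplus\mathcal{Q}}(t) = \frac{(1-t)(1-t^{\operatorname{lcm}(\operatorname{den}\mathcal{P},\operatorname{den}\mathcal{Q})})^{\dim\mathcal{P}+\dim\mathcal{Q}+1}}{(1-t^{\operatorname{den}\mathcal{P}})^{\dim\mathcal{P}+1}(1-t^{\operatorname{den}\mathcal{Q}})^{\dim\mathcal{Q}+1}}\,\delta_{\mathcal{P}}(t)\,\delta_{\mathcal{Q}}(t). \qquad (\ast\ast)$$ Conversely, if either $(\ast)$ or $(\ast\ast)$ holds, then either $\mathcal{P}^\vee$ or $\mathcal{Q}^\vee$ is a lattice polyhedron. In particular, if $\mathcal{P},\mathcal{Q}\subset\mathbb{R}^n$ are lattice polytopes such that $\mathcal{P}\oplus\mathcal{Q}$ is a free sum, then $\delta_{\mathcal{P}\oplus\mathcal{Q}} = \delta_{\mathcal{P}}\,\delta_{\mathcal{Q}}$ if and only if either $\mathcal{P}^\vee$ or $\mathcal{Q}^\vee$ is a lattice polyhedron.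
   Context: A rational (resp. lattice) polytope has all vertices in $\mathbb{Q}^n$ (resp. $\mathbb{Z}^n$). For convex $\mathcal{J},\mathcal{K}\subset\mathbb{R}^n$, $\mathcal{J}\oplus\mathcal{K}:=\operatorname{conv}(\mathcal{J}\cup\mathcal{K})$; "$\mathcal{J}\oplus\mathcal{K}$ is a free sum" means there is $g\in\mathsf{SL}_n(\mathbb{Z})$ such that $g\mathcal{J}$ and $g\mathcal{K}$ each contain the origin and their linear spans are orthogonal coordinate subspaces (spanned by subsets of the standard basis vectors). For a rational polytope $\mathcal{P}$, $\operatorname{Ehr}_{\mathcal{P}}(t)=1+\sum_{k\ge1}|k\mathcal{P}\cap\mathbb{Z}^n|\,t^k$, $\operatorname{den}\mathcal{P}$ is the smallest positive integer $d$ such that $d\mathcal{P}$ is a lattice polytope, and the $\delta$-polynomial $\delta_{\mathcal{P}}(t)$ is the polynomial with $\operatorname{Ehr}_{\mathcal{P}}(t)=\delta_{\mathcal{P}}(t)/(1-t^{\operatorname{den}\mathcal{P}})^{\dim\mathcal{P}+1}$. For a polytope $\mathcal{P}$ containing the origin, $\mathcal{P}^\vee=\{\phi\in(\operatorname{lin}\mathcal{P})^*: \phi(a)\le1\ \forall a\in\mathcal{P}\}$ (dual relative to the linear span); it is a lattice polyhedron if its vertices lie in $\{\phi\in(\operatorname{lin}\mathcal{P})^*:\phi(a)\in\mathbb{Z}\ \forall a\in\operatorname{lin}\mathcal{P}\cap\mathbb{Z}^n\}$. *)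

theory Defs
  imports
    "HOL-Analysis.Analysis"
    "HOL-Computational_Algebra.Computational_Algebra"
begin

definition int_lattice :: "(real ^ 'n) set" where
  "int_lattice = {x. \<forall>i. x $ i \<in> \<int>}"

definition rational_polytope :: "(real ^ 'n) set \<Rightarrow> bool" where
  "rational_polytope P \<longleftrightarrow> polytope P \<and> (\<forall>v. v extreme_point_of P \<longrightarrow> (\<forall>i. v $ i \<in> \<rat>))"

definition lattice_polytope :: "(real ^ 'n) set \<Rightarrow> bool" where
  "lattice_polytope P \<longleftrightarrow> polytope P \<and> (\<forall>v. v extreme_point_of P \<longrightarrow> v \<in> int_lattice)"

definition conv_union :: "(real ^ 'n) set \<Rightarrow> (real ^ 'n) set \<Rightarrow> (real ^ 'n) set" where
  "conv_union J K = convex hull (J \<union> K)"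

definition SL_int :: "(real ^ 'n ^ 'n) set" where
  "SL_int = {g. (\<forall>i j. g $ i $ j \<in> \<int>) \<and> det g = 1}"

definition coordinate_subspace :: "(real ^ 'n) set \<Rightarrow> bool" where
  "coordinate_subspace L \<longleftrightarrow> (\<exists>I :: 'n set. L = span ((\<lambda>i. axis i 1) ` I))"

text \<open>\<open>is_free_sum J K\<close> says that \<open>conv_union J K\<close> is a free sum.\<close>

definition is_free_sum :: "(real ^ 'n) set \<Rightarrow> (real ^ 'n) set \<Rightarrow> bool" where
  "is_free_sum J K \<longleftrightarrow>
     (\<exists>g \<in> SL_int.
        0 \<in> (*v) g ` J \<and> 0 \<in> (*v) g ` K \<and>
        coordinate_subspace (span ((*v) g ` J)) \<and>
        coordinate_subspace (span ((*v) g ` K)) \<and>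
        (\<forall>x \<in> span ((*v) g ` J). \<forall>y \<in> span ((*v) g ` K). orthogonal x y))"

text \<open>The series and polynomials below have real coefficients, so that the division of power
  series is available; every denominator that occurs has constant coefficient 1.\<close>

definition ehrhart_series :: "(real ^ 'n) set \<Rightarrow> real fps" where
  "ehrhart_series P =
     Abs_fps (\<lambda>k. if k = 0 then 1 else of_nat (card ((*\<^sub>R) (real k) ` P \<inter> int_lattice)))"

definition denominator :: "(real ^ 'n) set \<Rightarrow> nat" where
  "denominator P = (LEAST d. 0 < d \<and> lattice_polytope ((*\<^sub>R) (real d) ` P))"

text \<open>For a nonempty polytope \<open>aff_dim\<close> is nonnegative, so \<open>nat\<close> loses nothing. Existence of the
  polynomial is Ehrhart's theorem; uniqueness is clear.\<close>

definition delta_poly :: "(real ^ 'n) set \<Rightarrow> real poly" where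
  "delta_poly P =
     (THE p. ehrhart_series P = fps_of_poly p / (1 - fps_X ^ denominator P) ^ (nat (aff_dim P) + 1))"

text \<open>The dual space of a subspace \<open>L\<close>. A functional on \<open>L\<close> is represented by its extension to
  the whole space that vanishes on the orthogonal complement of \<open>L\<close>; by the lemma
  \<open>dual_space_represents\<close> restriction to \<open>L\<close> is then a (linear) bijection onto the functionals
  on \<open>L\<close>. This makes the dual a subspace of a normed vector space, as \<open>extreme_point_of\<close> needs.\<close>

definition dual_space :: "(real ^ 'n) set \<Rightarrow> ((real ^ 'n) \<Rightarrow>\<^sub>L real) set" where
  "dual_space L = {\<phi>. \<forall>x \<in> orthogonal_comp L. blinfun_apply \<phi> x = 0}"

lemma dual_space_represents:
  fixes L :: "(real ^ 'n) set" and f :: "real ^ 'n \<Rightarrow> real"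
  assumes L: "subspace L"
    and add: "\<And>x y. x \<in> L \<Longrightarrow> y \<in> L \<Longrightarrow> f (x + y) = f x + f y"
    and scale: "\<And>c x. x \<in> L \<Longrightarrow> f (c *\<^sub>R x) = c * f x"
  shows "\<exists>!\<phi>. \<phi> \<in> dual_space L \<and> (\<forall>x \<in> L. blinfun_apply \<phi> x = f x)"
proof (rule ex_ex1I)
  obtain B where B: "B \<subseteq> L" "independent B" "span B = L"
    using L by (metis basis_exists dim_subset_UNIV span_subspace)
  obtain h where h: "linear h" "\<And>x. x \<in> B \<Longrightarrow> h x = f x"
    using linear_independent_extend[OF B(2)] by (metis (no_types))
  interpret h: linear h by fact
  have hf: "h x = f x" if "x \<in> L" for x
  proof -
    have "x \<in> span B" using that B(3) by simp
    then have "x \<in> L \<and> h x = f x"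
    proof (induction rule: span_induct_alt)
      case base
      show ?case using scale[of 0 0] subspace_0[OF L] by (simp add: h.zero)
    next
      case (step c x y)
      then have "x \<in> L" using B(1) by blast
      then show ?case
        using step h(2)[of x] add[of "c *\<^sub>R x" y] scale[of x c] L
        by (auto simp: h.add h.scale subspace_add subspace_scale)
    qed
    then show ?thesis by simp
  qed
  define w where "w = adjoint h 1"
  have hw: "h x = x \<bullet> w" for x
    using adjoint_works[OF h(1), of x 1] by (simp add: w_def)
  obtain y z where y: "y \<in> L" and z: "\<And>u. u \<in> L \<Longrightarrow> orthogonal z u" and w: "w = y + z"
    using orthogonal_subspace_decomp_exists[of L w] span_eq_iff[of L] L by metis
  have "blinfun_inner_left y \<in> dual_space L"
    using y by (auto simp: dual_space_def orthogonal_comp_def orthogonal_def inner_commute)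
  moreover have "blinfun_inner_left y x = f x" if "x \<in> L" for x
    using hf[OF that] z[OF that] by (simp add: hw w inner_add_right orthogonal_def inner_commute)
  ultimately show "\<exists>\<phi>. \<phi> \<in> dual_space L \<and> (\<forall>x \<in> L. blinfun_apply \<phi> x = f x)"
    by blast
next
  fix \<phi> \<psi>
  assume *: "\<phi> \<in> dual_space L \<and> (\<forall>x \<in> L. blinfun_apply \<phi> x = f x)"
    "\<psi> \<in> dual_space L \<and> (\<forall>x \<in> L. blinfun_apply \<psi> x = f x)"
  show "\<phi> = \<psi>"
  proof (rule blinfun_eqI)
    fix x
    obtain y z where y: "y \<in> L" and z: "\<And>u. u \<in> L \<Longrightarrow> orthogonal z u" and x: "x = y + z"
      using orthogonal_subspace_decomp_exists[of L x] span_eq_iff[of L] L by metis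
    have "z \<in> orthogonal_comp L"
      using z by (auto simp: orthogonal_comp_def orthogonal_commute)
    then show "blinfun_apply \<phi> x = blinfun_apply \<psi> x"
      using * y by (simp add: x blinfun.add_right dual_space_def)
  qed
qed

definition dual_polyhedron :: "(real ^ 'n) set \<Rightarrow> ((real ^ 'n) \<Rightarrow>\<^sub>L real) set" where
  "dual_polyhedron P = {\<phi> \<in> dual_space (span P). \<forall>a \<in> P. blinfun_apply \<phi> a \<le> 1}"

definition dual_is_lattice_polyhedron :: "(real ^ 'n) set \<Rightarrow> bool" where
  "dual_is_lattice_polyhedron P \<longleftrightarrow>
     (\<forall>\<phi>. \<phi> extreme_point_of dual_polyhedron P \<longrightarrow>
        (\<forall>a \<in> span P \<inter> int_lattice. blinfun_apply \<phi> a \<in> \<int>))"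

end

theory Submission
  imports Defs
begin

text \<open>Write \<open>f\<close> and \<open>g\<close> for the gauges of \<open>P\<close> and \<open>Q\<close> on the lattice points of the cones over them. A free
  sum splits lattice points, so \<open>Ehr\<close> of the sum counts pairs \<open>(x, y)\<close> by \<open>\<lceil>f x + g y\<rceil>\<close>, whereas
  \<open>(1 - t) Ehr P Ehr Q\<close> counts them by \<open>\<lceil>f x\<rceil> + \<lceil>g y\<rceil>\<close>. The two agree iff \<open>f\<close> or \<open>g\<close> takes only integral
  values, and \<open>f\<close> is integral iff the dual of \<open>P\<close> is a lattice polyhedron: \<open>f\<close> is the maximum of the
  vertices of the dual, each of which equals \<open>f\<close> on a full-dimensional cone.

  For the polynomials one needs Ehrhart's theorem. The lattice points of the cone over \<open>P\<close> are a
  finitely generated module over the monoid of the scaled vertices, whence a rational series whose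
  denominator is a power of \<open>1 - t\<^sup>D\<close>; the exponent drops to \<open>dim P + 1\<close> because the coefficients grow like
  \<open>k\<close> to the power \<open>dim P\<close>.\<close>

section \<open>Down-closed sets of exponent vectors and their series\<close>

text \<open>\<open>delta_poly\<close> is a definite description, so nothing can be said about it
  before a numerator is known for exactly the exponent \<open>dim P + 1\<close>. Generating the cone
  by all vertices gives only the exponent \<open>card V\<close>, which is why rationality and the
  order of the poles are treated separately. Lattice points have many representations over the
  vertices. Instead of triangulating, one representation per point is singled out; the exponent
  vectors that occur form down-closed sets, and Dickson's lemma makes their series rational. The
  growth of the coefficients comes from the free sum itself: in the unimodular coordinates that it
  provides, \<open>P\<close> lies in a coordinate subspace, where a box counts lattice points. The
  origin may lie on the boundary of \<open>P\<close>. Then the gauge is finite only on a cone and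
  the dual is unbounded, so gauge and dual vertices are compared on cones, and the origin can be a
  vertex of \<open>P\<close> that disappears in the sum. The identity of delta polynomials is the
  identity of Ehrhart series multiplied by a power series with constant term 1, so the two are
  equivalent.\<close>

definition down_closed :: "nat list set \<Rightarrow> bool" where
  "down_closed S \<longleftrightarrow> (\<forall>xs ys. ys \<in> S \<longrightarrow> list_all2 (\<le>) xs ys \<longrightarrow> xs \<in> S)"

lemma down_closed_slice: "down_closed S \<Longrightarrow> down_closed {xs. i # xs \<in> S}"
  by (auto simp: down_closed_def)

lemma down_closed_slice_antimono:
  assumes "down_closed S" "i \<le> j" "j # xs \<in> S"
  shows "i # xs \<in> S"
proof -
  have "list_all2 (\<le>) (i # xs) (j # xs)"
    using assms(2) by (simp add: list_all2_refl)
  then show ?thesis using assms(1,3) unfolding down_closed_def by blast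
qed

text \<open>Dickson's lemma. The chain is compared with the diagonal of its slices, to which the
  induction hypothesis applies.\<close>

lemma down_closed_chain_stabilizes:
  fixes U :: "nat \<Rightarrow> nat list set"
  assumes "\<And>i. down_closed (U i)" "\<And>i j. i \<le> j \<Longrightarrow> U j \<subseteq> U i"
  shows "\<exists>m. \<forall>i\<ge>m. \<forall>xs. length xs = r \<longrightarrow> (xs \<in> U i \<longleftrightarrow> xs \<in> U m)"
  using assms
proof (induction r arbitrary: U)
  case 0
  show ?case
  proof (cases "\<forall>i. [] \<in> U i")
    case False
    then obtain m where "[] \<notin> U m" by auto
    then have "\<forall>i\<ge>m. [] \<notin> U i" using 0(2) by blast
    with \<open>[] \<notin> U m\<close> show ?thesis by auto
  qed auto
next
  case (Suc r)
  define V where "V i j = {xs. j # xs \<in> U i}" for i j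
  have dc: "down_closed (V i j)" for i j
    unfolding V_def by (intro down_closed_slice Suc.prems)
  have anti: "V i' j' \<subseteq> V i j" if "i \<le> i'" "j \<le> j'" for i i' j j'
    using that Suc.prems(2)[of i i'] down_closed_slice_antimono[OF Suc.prems(1)]
    by (auto simp: V_def)
  obtain m0 where m0: "\<And>i xs. m0 \<le> i \<Longrightarrow> length xs = r \<Longrightarrow> xs \<in> V i i \<longleftrightarrow> xs \<in> V m0 m0"
    using Suc.IH[of "\<lambda>i. V i i"] dc anti by (metis (no_types, lifting))
  have "\<forall>j. \<exists>m. \<forall>i\<ge>m. \<forall>xs. length xs = r \<longrightarrow> (xs \<in> V i j \<longleftrightarrow> xs \<in> V m j)"
    using Suc.IH[of "\<lambda>i. V i j" for j] dc anti by blast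
  then obtain mm where mm: "\<And>j i xs. mm j \<le> i \<Longrightarrow> length xs = r \<Longrightarrow> xs \<in> V i j \<longleftrightarrow> xs \<in> V (mm j) j"
    by metis
  \<comment> \<open>Heads from \<open>m0\<close> on are settled by the diagonal; each of the
    finitely many smaller heads has its own bound.\<close>
  define m where "m = Max (insert m0 (mm ` {..<m0}))"
  have m_ge: "m0 \<le> m" "\<And>j. j < m0 \<Longrightarrow> mm j \<le> m"
    by (auto simp: m_def)
  \<comment> \<open>\<open>V i j\<close> is squeezed between \<open>V m0 m0\<close> and a later
    diagonal slice, and these two agree on lists of length \<open>r\<close>.\<close>
  have late: "xs \<in> V i j \<longleftrightarrow> xs \<in> V m0 m0" if "m0 \<le> i" "m0 \<le> j" "length xs = r" for i j xs
    using that anti[of m0 i m0 j] anti[of i "max i j" j "max i j"] m0[of "max i j" xs] by auto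
  have slice: "xs \<in> V i j \<longleftrightarrow> xs \<in> V m j" if "m \<le> i" "length xs = r" for i j xs
  proof (cases "j < m0")
    case True
    then have "mm j \<le> m" by (rule m_ge)
    then show ?thesis using mm[of j i xs] mm[of j m xs] that by simp
  next
    case False
    then show ?thesis using late[of i j xs] late[of m j xs] m_ge that by auto
  qed
  have "xs \<in> U i \<longleftrightarrow> xs \<in> U m" if le: "m \<le> i" and len: "length xs = Suc r" for i xs
  proof -
    obtain j ys where "xs = j # ys" "length ys = r" using len by (cases xs) auto
    then show ?thesis using slice[OF le, of ys j] by (simp add: V_def)
  qed
  then show ?case by blast
qed

text \<open>For a down-closed \<open>U\<close> this is the Hilbert series of a polynomial ring in
  \<open>r\<close> variables of degree \<open>D\<close> modulo a monomial ideal: it counts the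
  monomials outside the ideal.\<close>

definition weight_series :: "nat \<Rightarrow> nat \<Rightarrow> nat list set \<Rightarrow> real fps" where
  "weight_series D r U =
     Abs_fps (\<lambda>k. real (card {xs \<in> U. length xs = r \<and> D * sum_list xs = k}))"

lemma finite_lists_of_weight:
  assumes "0 < D"
  shows "finite {xs :: nat list. xs \<in> U \<and> length xs = r \<and> D * sum_list xs = k}"
proof (rule finite_subset)
  have "x \<le> k" if "x \<in> set xs" "D * sum_list xs = k" for x xs
  proof -
    have "x \<le> sum_list xs" using that(1) by (intro member_le_sum_list) auto
    also have "\<dots> \<le> D * sum_list xs" using assms by simp
    finally show ?thesis using that(2) by simp
  qed
  then show "{xs. xs \<in> U \<and> length xs = r \<and> D * sum_list xs = k}
      \<subseteq> {xs. set xs \<subseteq> {..k} \<and> length xs = r}"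
    by auto
qed (simp add: finite_lists_length_eq)

lemma weight_series_Suc:
  assumes "0 < D"
  shows "weight_series D (Suc r) U =
    weight_series D r {xs. 0 # xs \<in> U} +
    fps_X ^ D * weight_series D (Suc r) {j # xs |j xs. Suc j # xs \<in> U}"
    (is "_ = weight_series D r ?S + _ * weight_series D (Suc r) ?T")
proof (rule fps_ext)
  fix k
  let ?A = "{xs \<in> U. length xs = Suc r \<and> D * sum_list xs = k}"
  let ?B = "{xs \<in> ?S. length xs = r \<and> D * sum_list xs = k}"
  let ?C = "{xs \<in> ?T. length xs = Suc r \<and> D * sum_list xs + D = k}"
  let ?inc = "\<lambda>xs. Suc (hd xs) # tl xs"
  have fC: "finite ?C"
    by (rule finite_subset[OF _ finite_lists_of_weight[OF assms, of UNIV "Suc r" "k - D"]]) auto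
  have A: "?A = Cons 0 ` ?B \<union> ?inc ` ?C"
  proof (intro equalityI subsetI)
    fix xs assume xs: "xs \<in> ?A"
    then obtain x ys where [simp]: "xs = x # ys" by (cases xs) auto
    show "xs \<in> Cons 0 ` ?B \<union> ?inc ` ?C"
    proof (cases x)
      case 0
      then show ?thesis using xs by auto
    next
      case (Suc y)
      then have "xs = ?inc (y # ys)" "y # ys \<in> ?C" using xs by (auto simp: algebra_simps)
      then show ?thesis by blast
    qed
  qed (auto simp: algebra_simps)
  have "card ?A = card (Cons 0 ` ?B) + card (?inc ` ?C)"
    unfolding A using fC finite_lists_of_weight[OF assms, of ?S r k]
    by (intro card_Un_disjoint) auto
  also have "card (Cons 0 ` ?B) = card ?B"
    by (intro card_image) (auto simp: inj_on_def)
  also have "card (?inc ` ?C) = card ?C"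
    by (intro card_image) (auto simp: inj_on_def)
  also have "?C = (if k < D then {} else {xs \<in> ?T. length xs = Suc r \<and> D * sum_list xs = k - D})"
    by auto
  finally show "fps_nth (weight_series D (Suc r) U) k =
      fps_nth (weight_series D r ?S + fps_X ^ D * weight_series D (Suc r) ?T) k"
    by (simp add: weight_series_def fps_X_power_mult_nth)
qed

text \<open>Outer induction on the number of variables, inner induction on the index
  \<open>m\<close> from which the slices agree. Lowering the first exponent shifts the slices, so
  \<open>m\<close> drops. At \<open>m = 0\<close> the shift changes nothing, and the recursion
  becomes an equation that is solved for the series.\<close>

lemma weight_series_down_closed:
  assumes D: "0 < D" and "down_closed U"
  shows "\<exists>p. weight_series D r U * (1 - fps_X ^ D) ^ r = fps_of_poly p"
  using assms(2)
proof (induction r arbitrary: U)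
  case 0
  have "weight_series D 0 U = fps_const (of_bool ([] \<in> U))"
  proof (rule fps_ext)
    fix k
    have "{xs \<in> U. length xs = 0 \<and> D * sum_list xs = k} = (if [] \<in> U \<and> k = 0 then {[]} else {})"
      by auto
    then show "fps_nth (weight_series D 0 U) k = fps_nth (fps_const (of_bool ([] \<in> U))) k"
      by (simp add: weight_series_def)
  qed
  then show ?case by (metis fps_of_poly_const mult.right_neutral power_0)
next
  case (Suc r)
  define V where "V U j = {xs. j # xs \<in> U}" for U :: "nat list set" and j :: nat
  note outer_IH = Suc.IH
  have "\<exists>m. \<forall>i\<ge>m. \<forall>xs. length xs = r \<longrightarrow> (xs \<in> V U i \<longleftrightarrow> xs \<in> V U m)"
    using Suc.prems
    by (intro down_closed_chain_stabilizes) 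
       (auto simp: V_def down_closed_slice intro: down_closed_slice_antimono)
  then obtain m where
    "\<And>i xs. m \<le> i \<Longrightarrow> length xs = r \<Longrightarrow> xs \<in> V U i \<longleftrightarrow> xs \<in> V U m"
    by blast
  then show ?case using Suc.prems
  proof (induction m arbitrary: U)
    case 0
    define T where "T = {j # xs |j xs. Suc j # xs \<in> U}"
    have "xs \<in> T \<longleftrightarrow> xs \<in> U" if len: "length xs = Suc r" for xs
    proof -
      obtain j ys where xs: "xs = j # ys" "length ys = r" using len by (cases xs) auto
      have "ys \<in> V U (Suc j) \<longleftrightarrow> ys \<in> V U j" using 0(1)[of "Suc j"] 0(1)[of j] xs by auto
      then show ?thesis by (simp add: V_def T_def xs)
    qed
    then have "weight_series D (Suc r) T = weight_series D (Suc r) U"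
      unfolding weight_series_def by (intro arg_cong[of _ _ Abs_fps] ext arg_cong[of _ _ real]
        arg_cong[of _ _ card]) auto
    then have "weight_series D (Suc r) U * (1 - fps_X ^ D) = weight_series D r (V U 0)"
      using weight_series_Suc[OF D, of r U] by (simp add: V_def T_def algebra_simps)
    moreover obtain p where "weight_series D r (V U 0) * (1 - fps_X ^ D) ^ r = fps_of_poly p"
      using Suc.IH[of "V U 0"] down_closed_slice[OF 0(2)] by (auto simp: V_def)
    ultimately show ?case by (metis mult.assoc power_Suc)
  next
    case (Suc m)
    define T where "T = {j # xs |j xs. Suc j # xs \<in> U}"
    have VT: "V T i = V U (Suc i)" for i by (auto simp: V_def T_def)
    have "down_closed T"
      unfolding down_closed_def
    proof (intro allI impI)
      fix xs ys assume "ys \<in> T" and le: "list_all2 (\<le>) xs ys"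
      then obtain j zs where ys: "ys = j # zs" "Suc j # zs \<in> U" by (auto simp: T_def)
      with le obtain i ws where xs: "xs = i # ws" by (cases xs) auto
      have "list_all2 (\<le>) (Suc i # ws) (Suc j # zs)" using le xs ys by simp
      then show "xs \<in> T" using Suc.prems(2) ys xs unfolding down_closed_def T_def by blast
    qed
    moreover have "xs \<in> V T i \<longleftrightarrow> xs \<in> V T m" if "m \<le> i" "length xs = r" for i xs
      using Suc.prems(1)[of "Suc i" xs] that by (simp add: VT)
    ultimately obtain q where "weight_series D (Suc r) T * (1 - fps_X ^ D) ^ Suc r = fps_of_poly q"
      using Suc.IH[of T] by blast
    moreover obtain p where "weight_series D r (V U 0) * (1 - fps_X ^ D) ^ r = fps_of_poly p"
      using outer_IH[of "V U 0"] down_closed_slice[OF Suc.prems(2)]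
      by (auto simp: V_def)
    moreover have "weight_series D (Suc r) U * (1 - fps_X ^ D) ^ Suc r =
        (weight_series D r (V U 0) * (1 - fps_X ^ D) ^ r) * (1 - fps_X ^ D) +
        fps_X ^ D * (weight_series D (Suc r) T * (1 - fps_X ^ D) ^ Suc r)"
      unfolding weight_series_Suc[OF D, of r U] V_def T_def by (simp only: power_Suc ring_distribs mult_ac)
    ultimately have "weight_series D (Suc r) U * (1 - fps_X ^ D) ^ Suc r =
        fps_of_poly p * (1 - fps_X ^ D) + fps_X ^ D * fps_of_poly q"
      by simp
    also have "\<dots> = fps_of_poly (p * (1 - monom 1 D) + monom 1 D * q)"
      by (simp add: fps_of_poly_mult fps_of_poly_add fps_of_poly_diff fps_of_poly_monom)
    finally show ?case by blast
  qed
qed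

section \<open>Lexicographic order and series of finitely generated modules\<close>

lemma lex_imp_length_eq: "(xs, ys) \<in> lex R \<Longrightarrow> length xs = length ys"
  by (simp add: lex_conv)

text \<open>Translation invariance, as for a monomial order: a better representation of a smaller
  vector yields a better one of the larger vector.\<close>

lemma lex_map2_add:
  assumes "(as, bs) \<in> lex less_than" "length ds = length bs"
  shows "(map2 (+) as ds, map2 (+) bs ds) \<in> lex (less_than :: (nat \<times> nat) set)"
  using assms
proof (induction bs arbitrary: as ds)
  case (Cons b bs)
  then obtain a as' where "as = a # as'" by (cases as) auto
  moreover obtain d ds' where "ds = d # ds'" using Cons.prems by (cases ds) auto
  ultimately show ?case
    using Cons by (auto dest: lex_imp_length_eq)
qed simp

lemma lex_total:
  assumes "length xs = length ys" "xs \<noteq> ys"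
  shows "(xs, ys) \<in> lex less_than \<or> (ys, xs) \<in> lex (less_than :: (nat \<times> nat) set)"
  using assms by (induction rule: list_induct2) auto

definition nat_comb :: "'a::real_vector list \<Rightarrow> nat list \<Rightarrow> 'a" where
  "nat_comb ws xs = (\<Sum>(w, x) \<leftarrow> zip ws xs. real x *\<^sub>R w)"

lemma nat_comb_add:
  "length xs = length ws \<Longrightarrow> length ys = length ws \<Longrightarrow>
     nat_comb ws (map2 (+) xs ys) = nat_comb ws xs + nat_comb ws ys"
proof (induction ws arbitrary: xs ys)
  case (Cons w ws)
  then obtain x xs' y ys' where "xs = x # xs'" "ys = y # ys'"
    by (cases xs; cases ys) auto
  with Cons show ?case by (auto simp: nat_comb_def algebra_simps)
qed (simp add: nat_comb_def)

lemma sum_list_map2_add: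
  "length xs = length ys \<Longrightarrow> sum_list (map2 (+) xs ys) = sum_list xs + sum_list (ys :: nat list)"
  by (induction rule: list_induct2) auto

text \<open>A module over the monoid spanned by \<open>ws\<close> (placed in degree \<open>D\<close>) with the finitely many
  generators \<open>bs\<close> (each paired with its degree). Every element is counted through its
  lexicographically least representation; least representations are stable under
  decreasing coefficients.\<close>

lemma finitely_generated_series:
  fixes M :: "nat \<Rightarrow> 'a::real_vector set"
  assumes D: "0 < D"
    and M: "\<And>k. M k = {fst (bs ! c) + nat_comb ws xs |c xs. c < length bs \<and>
                  length xs = length ws \<and> snd (bs ! c) + D * sum_list xs = k}"
  shows "\<exists>p. Abs_fps (\<lambda>k. real (card (M k))) * (1 - fps_X ^ D) ^ length ws = fps_of_poly p"
proof -
  define r where "r = length ws"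
  define val where "val c xs = fst (bs ! c) + nat_comb ws xs" for c xs
  define deg where "deg c xs = snd (bs ! c) + D * sum_list xs" for c xs
  \<comment> \<open>The index of the generator heads the word, so that representations by different
    generators can be compared too.\<close>
  define better where "better c xs c' xs' \<longleftrightarrow> c' < length bs \<and> length xs' = r \<and>
      val c' xs' = val c xs \<and> deg c' xs' = deg c xs \<and> (c' # xs', c # xs) \<in> lex less_than"
    for c c' :: nat and xs xs' :: "nat list"
  define N where "N c = {xs. length xs = r \<and> (\<forall>c' xs'. \<not> better c xs c' xs')}" for c
  have down: "down_closed (N c)" for c
    unfolding down_closed_def
  proof (intro allI impI)
    fix ys xs assume xs: "xs \<in> N c" and le: "list_all2 (\<le>) ys xs"
    have len: "length xs = r" "length ys = r"
      using xs le by (auto simp: N_def list_all2_lengthD)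
    define d where "d = map2 (-) xs ys"
    have len_d: "length d = r" using len by (simp add: d_def)
    have xs_eq: "xs = map2 (+) ys d"
      using le len by (auto simp: d_def list_eq_iff_nth_eq list_all2_conv_all_nth)
    have "False" if b: "better c ys c' zs" for c' zs
    proof -
      have lz: "length zs = r" using b by (simp add: better_def)
      \<comment> \<open>The leading 0 leaves the indices of the generators untouched by the
        translation.\<close>
      have "(map2 (+) (c' # zs) (0 # d), map2 (+) (c # ys) (0 # d)) \<in> lex less_than"
        using b len len_d by (intro lex_map2_add) (auto simp: better_def)
      moreover have "val c' (map2 (+) zs d) = val c xs" "deg c' (map2 (+) zs d) = deg c xs"
        using b len len_d lz unfolding xs_eq
        by (auto simp: better_def val_def deg_def nat_comb_add r_def sum_list_map2_add algebra_simps)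
      ultimately have "better c xs c' (map2 (+) zs d)"
        using b len len_d lz by (simp add: better_def xs_eq)
      then show False using xs by (simp add: N_def)
    qed
    then show "ys \<in> N c" using len by (auto simp: N_def)
  qed
  define A where "A c k = {xs \<in> N c. length xs = r \<and> deg c xs = k}" for c k
  have fin: "finite (A c k)" for c k
    by (rule finite_subset[OF _ finite_lists_of_weight[OF D, of UNIV r "k - snd (bs ! c)"]])
      (auto simp: A_def deg_def)
  \<comment> \<open>Injective, since of two distinct representations of one element one is better;
    onto, since \<open>lex\<close> is well-founded.\<close>
  have bij: "bij_betw (\<lambda>(c, xs). val c xs) (SIGMA c:{..<length bs}. A c k) (M k)" for k
  proof (rule bij_betw_imageI)
    show "inj_on (\<lambda>(c, xs). val c xs) (SIGMA c:{..<length bs}. A c k)"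
    proof (rule inj_onI, clarify)
      fix c xs c' xs'
      assume *: "c < length bs" "xs \<in> A c k" "c' < length bs" "xs' \<in> A c' k" "val c xs = val c' xs'"
      have "\<not> better c xs c' xs'" "\<not> better c' xs' c xs" using * by (auto simp: A_def N_def)
      then have "(c' # xs', c # xs) \<notin> lex less_than" "(c # xs, c' # xs') \<notin> lex less_than"
        using * by (auto simp: better_def A_def)
      then show "c = c' \<and> xs = xs'"
        using lex_total[of "c # xs" "c' # xs'"] * by (auto simp: A_def)
    qed
    show "(\<lambda>(c, xs). val c xs) ` (SIGMA c:{..<length bs}. A c k) = M k"
    proof (intro equalityI subsetI)
      fix x assume "x \<in> (\<lambda>(c, xs). val c xs) ` (SIGMA c:{..<length bs}. A c k)"
      then show "x \<in> M k" by (auto simp: M A_def val_def deg_def r_def)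
    next
      fix x assume "x \<in> M k"
      define R where "R = {c # xs |c xs. c < length bs \<and> length xs = r \<and> val c xs = x \<and> deg c xs = k}"
      from \<open>x \<in> M k\<close> obtain z where "z \<in> R"
        by (auto simp: M R_def val_def deg_def r_def)
      have "wf (lex (less_than :: (nat \<times> nat) set))" by (simp add: wf_lex)
      then obtain z where z: "z \<in> R" "\<And>y. (y, z) \<in> lex less_than \<Longrightarrow> y \<notin> R"
        using wfE_min[of "lex less_than" _ R] \<open>z \<in> R\<close> by metis
      then obtain c xs where cx: "z = c # xs" "c < length bs" "length xs = r" "val c xs = x" "deg c xs = k"
        by (auto simp: R_def)
      have "\<not> better c xs c' xs'" for c' xs'
        using z(2)[of "c' # xs'"] cx by (auto simp: better_def R_def)
      then have "xs \<in> A c k" using cx by (auto simp: A_def N_def)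
      then show "x \<in> (\<lambda>(c, xs). val c xs) ` (SIGMA c:{..<length bs}. A c k)"
        using cx by force
    qed
  qed
  have card_M: "card (M k) = (\<Sum>c<length bs. card (A c k))" for k
    using bij_betw_same_card[OF bij[of k]] fin by (simp add: card_SigmaI)
  have series: "Abs_fps (\<lambda>k. real (card (M k))) =
      (\<Sum>c<length bs. fps_X ^ snd (bs ! c) * weight_series D r (N c))"
  proof (rule fps_ext)
    fix k
    have "real (card (A c k)) = fps_nth (fps_X ^ snd (bs ! c) * weight_series D r (N c)) k" for c
    proof -
      have "A c k = (if k < snd (bs ! c) then {}
          else {xs \<in> N c. length xs = r \<and> D * sum_list xs = k - snd (bs ! c)})"
        by (auto simp: A_def deg_def)
      then show ?thesis by (simp add: fps_X_power_mult_nth weight_series_def)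
    qed
    then show "fps_nth (Abs_fps (\<lambda>k. real (card (M k)))) k =
      fps_nth (\<Sum>c<length bs. fps_X ^ snd (bs ! c) * weight_series D r (N c)) k"
      by (simp add: card_M fps_sum_nth)
  qed
  obtain p where p: "\<And>c. weight_series D r (N c) * (1 - fps_X ^ D) ^ r = fps_of_poly (p c)"
    using weight_series_down_closed[OF D down] by metis
  have "Abs_fps (\<lambda>k. real (card (M k))) * (1 - fps_X ^ D) ^ r =
      (\<Sum>c<length bs. fps_X ^ snd (bs ! c) * fps_of_poly (p c))"
    unfolding series sum_distrib_right mult.assoc p ..
  also have "\<dots> = fps_of_poly (\<Sum>c<length bs. monom 1 (snd (bs ! c)) * p c)"
    by (simp add: fps_of_poly_sum fps_of_poly_mult fps_of_poly_monom)
  finally show ?thesis unfolding r_def by blast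
qed

section \<open>Growth of coefficients and order of poles\<close>

definition fwd_diff :: "(nat \<Rightarrow> real) \<Rightarrow> nat \<Rightarrow> real" where
  "fwd_diff u m = u (Suc m) - u m"

lemma funpow_fwd_diff_diff:
  "(fwd_diff ^^ n) (\<lambda>m. u m - v m) = (\<lambda>m. (fwd_diff ^^ n) u m - (fwd_diff ^^ n) v m)"
  by (induction n) (auto simp: fwd_diff_def)

lemma funpow_fwd_diff_binomial:
  "(fwd_diff ^^ n) (\<lambda>m. c * real (m choose n)) = (\<lambda>m. c)"
proof (induction n)
  case (Suc n)
  have "fwd_diff (\<lambda>m. c * real (m choose Suc n)) = (\<lambda>m. c * real (m choose n))"
    by (auto simp: fwd_diff_def algebra_simps)
  with Suc show ?case by (simp add: funpow_swap1 del: binomial_Suc_Suc)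
qed simp

text \<open>Each summation raises the order of growth by at most one, starting from a constant
  sequence.\<close>

lemma funpow_fwd_diff_zero_bound:
  assumes "\<And>m. (fwd_diff ^^ Suc n) u m = 0"
  shows "\<exists>B. \<forall>m. \<bar>u m\<bar> \<le> B * real (Suc m) ^ n"
  using assms
proof (induction n arbitrary: u)
  case 0
  have "u m = u 0" for m
  proof (induction m)
    case (Suc m)
    then show ?case using 0[of m] by (simp add: fwd_diff_def)
  qed simp
  then have "\<forall>m. \<bar>u m\<bar> \<le> \<bar>u 0\<bar> * real (Suc m) ^ 0" by (metis mult.right_neutral order_refl power_0)
  then show ?case by blast
next
  case (Suc n)
  have "(fwd_diff ^^ Suc n) (fwd_diff u) m = 0" for m
    using Suc.prems[of m] by (simp add: funpow_swap1)
  from Suc.IH[OF this] obtain B where B: "\<And>m. \<bar>fwd_diff u m\<bar> \<le> B * real (Suc m) ^ n"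
    by blast
  have "0 \<le> B" using B[of 0] by simp
  have "\<bar>u m\<bar> \<le> \<bar>u 0\<bar> + real m * (B * real (Suc m) ^ n)" for m
  proof (induction m)
    case (Suc m)
    have mono: "B * real (Suc m) ^ n \<le> B * real (Suc (Suc m)) ^ n"
      using \<open>0 \<le> B\<close> by (intro mult_left_mono power_mono) auto
    have "\<bar>u (Suc m)\<bar> \<le> \<bar>u m\<bar> + \<bar>fwd_diff u m\<bar>" by (simp add: fwd_diff_def)
    also have "\<dots> \<le> \<bar>u 0\<bar> + real m * (B * real (Suc m) ^ n) + B * real (Suc m) ^ n"
      using Suc B[of m] by simp
    also have "\<dots> \<le> \<bar>u 0\<bar> + real m * (B * real (Suc (Suc m)) ^ n) + B * real (Suc (Suc m)) ^ n"
      by (intro add_mono mult_left_mono[OF mono] mono order_refl) auto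
    finally show ?case by (simp add: algebra_simps)
  qed simp
  also have "\<bar>u 0\<bar> + real m * (B * real (Suc m) ^ n) \<le> (\<bar>u 0\<bar> + B) * real (Suc m) ^ Suc n" for m
  proof -
    have "\<bar>u 0\<bar> * 1 \<le> \<bar>u 0\<bar> * real (Suc m) ^ Suc n"
      by (intro mult_left_mono one_le_power) auto
    moreover have "real m * (B * real (Suc m) ^ n) \<le> real (Suc m) * (B * real (Suc m) ^ n)"
      using \<open>0 \<le> B\<close> by (intro mult_right_mono) auto
    ultimately show ?thesis by (simp add: algebra_simps)
  qed
  finally show ?case by blast
qed

text \<open>Subtracting \<open>c * real (m choose N)\<close> leaves a sequence whose
  \<open>N\<close>-th differences vanish, hence of growth below \<open>N\<close>. Unless
  \<open>c = 0\<close>, the binomial term grows like the \<open>N\<close>-th power of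
  \<open>m\<close>, against the bound of order \<open>d\<close>.\<close>

lemma fwd_diff_const_imp_zero:
  assumes const: "\<And>m. (fwd_diff ^^ N) u m = c"
    and bound: "\<And>m. \<bar>u m\<bar> \<le> C * real (Suc m) ^ d" and "d < N"
  shows "c = 0"
proof (rule ccontr)
  assume "c \<noteq> 0"
  obtain n where N: "N = Suc n" "d \<le> n" using \<open>d < N\<close> by (cases N) auto
  have "0 \<le> C" using bound[of 0] by simp
  have "(fwd_diff ^^ Suc n) (\<lambda>m. u m - c * real (m choose N)) m = 0" for m
    using const[of m] funpow_fwd_diff_binomial[of N c]
    by (simp only: funpow_fwd_diff_diff N(1)[symmetric])
  from funpow_fwd_diff_zero_bound[OF this]
  obtain B where B: "\<And>m. \<bar>u m - c * real (m choose N)\<bar> \<le> B * real (Suc m) ^ n"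
    by blast
  have "0 \<le> B" using B[of 0] by simp
  have "0 < real N ^ N" by (simp add: N(1))
  \<comment> \<open>The threshold results from \<open>(m / N) ^ N \<le> m choose N\<close> and
    \<open>Suc m \<le> 2 * m\<close> after cancelling \<open>m ^ n\<close>.\<close>
  define E where "E = (B + C) * 2 ^ n * real N ^ N / \<bar>c\<bar>"
  have le_E: "real m \<le> E" if "N \<le> m" "0 < m" for m
  proof -
    have "\<bar>c\<bar> * (real m / real N) ^ N \<le> \<bar>c\<bar> * real (m choose N)"
      using that by (intro mult_left_mono binomial_ge_n_over_k_pow_k) auto
    also have "\<dots> \<le> \<bar>u m - c * real (m choose N)\<bar> + \<bar>u m\<bar>" by (simp add: abs_mult[symmetric])
    also have "\<dots> \<le> B * real (Suc m) ^ n + C * real (Suc m) ^ d"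
      by (intro add_mono B bound)
    also have "\<dots> \<le> B * real (Suc m) ^ n + C * real (Suc m) ^ n"
      using \<open>0 \<le> C\<close> \<open>0 \<le> B\<close> N(2) by (intro add_mono mult_left_mono power_increasing) auto
    also have "\<dots> \<le> (B + C) * (2 * real m) ^ n"
      unfolding distrib_right using \<open>0 \<le> B\<close> \<open>0 \<le> C\<close> that
      by (intro add_mono mult_left_mono power_mono) auto
    finally have "\<bar>c\<bar> * (real m / real N) ^ N \<le> (B + C) * (2 * real m) ^ n" .
    then have "\<bar>c\<bar> * real m ^ N \<le> (B + C) * (2 * real m) ^ n * real N ^ N"
      using \<open>0 < real N ^ N\<close> by (simp add: power_divide pos_divide_le_eq)
    then have "(\<bar>c\<bar> * real m) * real m ^ n \<le> ((B + C) * 2 ^ n * real N ^ N) * real m ^ n"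
      by (simp add: N(1) power_mult_distrib mult_ac)
    then have "\<bar>c\<bar> * real m \<le> (B + C) * 2 ^ n * real N ^ N"
      using that by (simp add: mult_le_cancel_right)
    then show ?thesis using \<open>c \<noteq> 0\<close> by (simp add: E_def field_simps)
  qed
  obtain m where "E < real m" using reals_Archimedean2 by blast
  then show False using le_E[of "Suc (m + N)"] by simp
qed

lemma fps_mult_one_minus_X_power_nth:
  fixes F :: "real fps"
  shows "fps_nth (F * (1 - fps_X ^ D)) k = fps_nth F k - (if k < D then 0 else fps_nth F (k - D))"
  by (simp add: algebra_simps fps_X_power_mult_right_nth)

text \<open>Along a residue class modulo \<open>D\<close>, a factor \<open>1 - fps_X ^ D\<close> is
  a forward difference. The shift by \<open>D * n\<close> arises because differences look ahead
  whereas the product looks back.\<close>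

lemma funpow_fwd_diff_fps:
  fixes F :: "real fps"
  shows "(fwd_diff ^^ n) (\<lambda>m. fps_nth F (k + D * m)) m =
         fps_nth (F * (1 - fps_X ^ D) ^ n) (k + D * (m + n))"
proof (induction n arbitrary: m)
  case (Suc n)
  have "fps_nth (F * (1 - fps_X ^ D) ^ Suc n) (k + D * (m + Suc n)) =
        fps_nth ((F * (1 - fps_X ^ D) ^ n) * (1 - fps_X ^ D)) (k + D * (m + Suc n))"
    by (simp only: power_Suc mult_ac)
  also have "\<dots> = fps_nth (F * (1 - fps_X ^ D) ^ n) (k + D * (Suc m + n)) -
        fps_nth (F * (1 - fps_X ^ D) ^ n) (k + D * (m + n))"
    by (subst fps_mult_one_minus_X_power_nth) (simp add: algebra_simps)
  finally show ?case using Suc[of m] Suc[of "Suc m"] by (simp add: fwd_diff_def)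
qed simp

lemma fps_eventually_zero_imp_poly:
  assumes "\<And>k. K \<le> k \<Longrightarrow> fps_nth G k = (0 :: 'a :: comm_semiring_1)"
  shows "\<exists>p. G = fps_of_poly p"
proof
  show "G = fps_of_poly (Poly (map (fps_nth G) [0..<K]))"
    using assms by (intro fps_ext) (auto simp: nth_default_def)
qed

text \<open>The order of the poles is bounded by the growth of the coefficients.\<close>

lemma polynomial_growth_reduces_exponent:
  fixes F :: "real fps"
  assumes D: "0 < D" and growth: "\<And>k. \<bar>fps_nth F k\<bar> \<le> C * real (Suc k) ^ d"
    and "F * (1 - fps_X ^ D) ^ N = fps_of_poly p"
  shows "\<exists>q. F * (1 - fps_X ^ D) ^ Suc d = fps_of_poly q"
proof -
  have C0: "0 \<le> C" using growth[of 0] by simp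
  have "\<exists>q. F * (1 - fps_X ^ D) ^ Suc d = fps_of_poly q"
    if "F * (1 - fps_X ^ D) ^ (Suc d + n) = fps_of_poly p" for n p
    using that
  proof (induction n arbitrary: p)
    case (Suc n)
    define G where "G = F * (1 - fps_X ^ D) ^ (Suc d + n)"
    have "G * (1 - fps_X ^ D) = F * (1 - fps_X ^ D) ^ (Suc d + Suc n)"
      by (simp add: G_def mult_ac)
    from this Suc.prems have Gp: "G * (1 - fps_X ^ D) = fps_of_poly p" by (rule trans)
    have step: "fps_nth G (k + D) = fps_nth G k" if "degree p < k" for k
    proof -
      have "fps_nth (G * (1 - fps_X ^ D)) (k + D) = 0"
        unfolding Gp using that by (simp add: coeff_eq_0)
      then show ?thesis by (simp add: fps_mult_one_minus_X_power_nth)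
    qed
    \<comment> \<open>On the residue class of \<open>k\<close> the coefficients of \<open>G\<close>
      are the differences of \<open>F\<close> of order \<open>Suc d + n\<close>. Past the degree of
      \<open>p\<close> they are constant, and the growth of order \<open>d\<close> forces this
      constant to be 0.\<close>
    have "fps_nth G k = 0" if k: "Suc (degree p) \<le> k" for k
    proof (rule fwd_diff_const_imp_zero)
      have period: "fps_nth G (k + D * m) = fps_nth G k" for m
      proof (induction m)
        case (Suc m)
        then show ?case using step[of "k + D * m"] k by (simp add: algebra_simps)
      qed simp
      show "(fwd_diff ^^ (Suc d + n)) (\<lambda>m. fps_nth F (k + D * m)) m = fps_nth G k" for m
        unfolding funpow_fwd_diff_fps G_def[symmetric] by (rule period)
      show "\<bar>fps_nth F (k + D * m)\<bar> \<le> (C * real (Suc (k + D)) ^ d) * real (Suc m) ^ d" for m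
      proof -
        have "Suc (k + D * m) \<le> Suc (k + D) * Suc m" by (simp add: algebra_simps)
        then have "real (Suc (k + D * m)) \<le> real (Suc (k + D)) * real (Suc m)"
          by (metis of_nat_le_iff of_nat_mult)
        then have "C * real (Suc (k + D * m)) ^ d \<le> C * (real (Suc (k + D)) * real (Suc m)) ^ d"
          using C0 by (intro mult_left_mono power_mono) auto
        then show ?thesis using growth[of "k + D * m"] by (simp only: power_mult_distrib mult_ac)
      qed
    qed simp
    then obtain q where "G = fps_of_poly q" using fps_eventually_zero_imp_poly by blast
    then show ?case using Suc.IH[of q] by (simp only: G_def)
  qed auto
  \<comment> \<open>Extra factors bring an arbitrary \<open>N\<close> into the form
    \<open>Suc d + n\<close>, from which they are removed one at a time.\<close>
  moreover have "F * (1 - fps_X ^ D) ^ (Suc d + N) = fps_of_poly (p * (1 - monom 1 D) ^ Suc d)"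
  proof -
    have "F * (1 - fps_X ^ D) ^ (Suc d + N) = (F * (1 - fps_X ^ D) ^ N) * (1 - fps_X ^ D) ^ Suc d"
      by (simp only: power_add mult_ac)
    then show ?thesis using assms(3)
      by (simp only: fps_of_poly_mult fps_of_poly_power fps_of_poly_diff fps_of_poly_monom
          fps_of_poly_1 fps_const_1_eq_1 mult_1_left)
  qed
  ultimately show ?thesis by blast
qed

section \<open>Lattice points and the rationality of Ehrhart series\<close>

lemma int_lattice_add: "x \<in> int_lattice \<Longrightarrow> y \<in> int_lattice \<Longrightarrow> x + y \<in> int_lattice"
  and int_lattice_diff: "x \<in> int_lattice \<Longrightarrow> y \<in> int_lattice \<Longrightarrow> x - y \<in> int_lattice"
  and int_lattice_zero: "0 \<in> int_lattice"
  and int_lattice_of_nat: "x \<in> int_lattice \<Longrightarrow> real k *\<^sub>R x \<in> int_lattice"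
  by (auto simp: int_lattice_def)

lemma int_lattice_sum: "(\<And>i. i \<in> A \<Longrightarrow> f i \<in> int_lattice) \<Longrightarrow> sum f A \<in> int_lattice"
  by (induction A rule: infinite_finite_induct) (auto simp: int_lattice_zero int_lattice_add)

text \<open>The exponent is the number of free coordinates, not the dimension of the ambient space;
  this becomes the exponent of growth \<open>dim P\<close>.\<close>

lemma card_int_lattice_box:
  fixes I :: "'n::finite set"
  shows "finite {x \<in> int_lattice. (\<forall>i\<in>I. \<bar>x $ i\<bar> \<le> real N) \<and> (\<forall>i. i \<notin> I \<longrightarrow> x $ i = 0)}" (is "finite ?A")
    and "card {x \<in> int_lattice. (\<forall>i\<in>I. \<bar>x $ i\<bar> \<le> real N) \<and> (\<forall>i. i \<notin> I \<longrightarrow> x $ i = 0)}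
           \<le> (2 * N + 1) ^ card I"
proof -
  define B where "B = PiE I (\<lambda>_. {- int N..int N})"
  define h where "h f = (\<chi> i. if i \<in> I then real_of_int (f i) else 0)" for f :: "'n \<Rightarrow> int"
  have fB: "finite B" by (simp add: B_def finite_PiE)
  have sub: "?A \<subseteq> h ` B"
  proof
    fix x assume x: "x \<in> ?A"
    define f where "f = (\<lambda>i\<in>I. \<lfloor>x $ i\<rfloor>)"
    have int: "real_of_int \<lfloor>x $ i\<rfloor> = x $ i" for i
      using x by (auto simp: int_lattice_def elim!: Ints_cases)
    have "\<lfloor>x $ i\<rfloor> \<in> {- int N..int N}" if "i \<in> I" for i
    proof -
      have "\<bar>real_of_int \<lfloor>x $ i\<rfloor>\<bar> \<le> real N" using x that by (simp add: int)
      then show ?thesis by simp linarith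
    qed
    then have "f \<in> B" by (auto simp: B_def f_def)
    moreover have "x = h f" using x by (auto simp: vec_eq_iff h_def f_def int)
    ultimately show "x \<in> h ` B" by blast
  qed
  then show "finite ?A" using fB finite_surj by blast
  have "card ?A \<le> card (h ` B)" using sub fB by (intro card_mono) auto
  also have "\<dots> \<le> card B" using fB by (rule card_image_le)
  also have "card B = (2 * N + 1) ^ card I"
    by (simp add: B_def card_PiE nat_add_distrib nat_mult_distrib)
  finally show "card ?A \<le> (2 * N + 1) ^ card I" .
qed

lemma finite_bounded_Int_int_lattice:
  fixes S :: "(real ^ 'n) set"
  assumes "bounded S"
  shows "finite (S \<inter> int_lattice)"
proof -
  obtain R where R: "\<And>x. x \<in> S \<Longrightarrow> norm x \<le> R" using assms by (auto simp: bounded_iff)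
  have "S \<inter> int_lattice \<subseteq> {x \<in> int_lattice. (\<forall>i\<in>UNIV. \<bar>x $ i\<bar> \<le> real (nat \<lceil>R\<rceil>)) \<and> (\<forall>i. i \<notin> UNIV \<longrightarrow> x $ i = 0)}"
  proof clarsimp
    fix x i assume "x \<in> S"
    have "\<bar>x $ i\<bar> \<le> R" using R[OF \<open>x \<in> S\<close>] component_le_norm_cart[of x i] by linarith
    then show "\<bar>x $ i\<bar> \<le> real (nat \<lceil>R\<rceil>)" by linarith
  qed
  then show ?thesis using card_int_lattice_box(1) finite_subset by blast
qed

lemma scaleR_image_add:
  assumes "convex P" "0 \<le> a" "0 \<le> b" "x \<in> (*\<^sub>R) a ` P" "y \<in> (*\<^sub>R) b ` P"
  shows "x + y \<in> (*\<^sub>R) (a + b) ` P"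
proof -
  obtain p q where p: "p \<in> P" "x = a *\<^sub>R p" and q: "q \<in> P" "y = b *\<^sub>R q" using assms by auto
  show ?thesis
  proof (cases "a + b = 0")
    case True
    then have "x + y = (a + b) *\<^sub>R p" using p q assms by (simp add: add_nonneg_eq_0_iff)
    then show ?thesis using p by blast
  next
    case False
    then have pos: "0 < a + b" using assms by linarith
    have "(a / (a + b)) *\<^sub>R p + (b / (a + b)) *\<^sub>R q \<in> P"
      using assms p q pos by (intro convexD) (auto simp: add_divide_distrib[symmetric])
    moreover have "x + y = (a + b) *\<^sub>R ((a / (a + b)) *\<^sub>R p + (b / (a + b)) *\<^sub>R q)"
      using pos p q by (simp add: scaleR_add_right)
    ultimately show ?thesis by blast
  qed
qed

lemma scaleR_image_sum:
  assumes "convex P" "P \<noteq> {}" "finite V" "V \<subseteq> P" "\<And>v. v \<in> V \<Longrightarrow> 0 \<le> c v"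
  shows "(\<Sum>v\<in>V. c v *\<^sub>R v) \<in> (*\<^sub>R) (sum c V) ` P"
  using assms(3-5)
proof (induction V rule: finite_induct)
  case empty
  then show ?case using assms(2) by auto
next
  case (insert v V)
  then show ?case
    using scaleR_image_add[OF assms(1), of "c v" "sum c V" "c v *\<^sub>R v"] by (auto simp: sum_nonneg)
qed

lemma scaleR_image_mono:
  assumes "convex P" "0 \<in> P" "0 \<le> a" "a \<le> b"
  shows "(*\<^sub>R) a ` P \<subseteq> (*\<^sub>R) b ` P"
  using scaleR_image_add[OF assms(1,3), of "b - a" _ 0] assms by fastforce

lemma nat_comb_in_scaleR_image:
  assumes "convex P" "P \<noteq> {}" "\<And>w. w \<in> set ws \<Longrightarrow> w \<in> (*\<^sub>R) D ` P" "0 \<le> D"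
    "length xs = length ws"
  shows "nat_comb ws xs \<in> (*\<^sub>R) (D * real (sum_list xs)) ` P"
  using assms(5,3)
proof (induction xs ws rule: list_induct2)
  case Nil
  then show ?case using assms(2) by (auto simp: nat_comb_def)
next
  case (Cons x xs w ws)
  have "real x *\<^sub>R w \<in> (*\<^sub>R) (real x * D) ` P" using Cons.prems[of w] by auto
  moreover have "nat_comb ws xs \<in> (*\<^sub>R) (D * real (sum_list xs)) ` P" using Cons by auto
  ultimately have "real x *\<^sub>R w + nat_comb ws xs \<in> (*\<^sub>R) (real x * D + D * real (sum_list xs)) ` P"
    using assms(1,4) by (intro scaleR_image_add) auto
  then show ?case by (simp add: nat_comb_def algebra_simps)
qed

lemma nat_comb_in_int_lattice:
  assumes "\<And>w. w \<in> set ws \<Longrightarrow> w \<in> int_lattice" "length xs = length ws"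
  shows "nat_comb ws xs \<in> int_lattice"
  using assms(2,1)
  by (induction xs ws rule: list_induct2)
    (auto simp: nat_comb_def int_lattice_zero intro!: int_lattice_add int_lattice_of_nat)

lemma nat_comb_map:
  "distinct vs \<Longrightarrow> nat_comb (map g vs) (map f vs) = (\<Sum>v\<in>set vs. real (f v) *\<^sub>R g v)"
  by (induction vs) (auto simp: nat_comb_def)

text \<open>The constant coefficient 1 is a genuine count, because the dilate by 0 is the
  origin.\<close>

lemma ehrhart_series_eq:
  assumes "P \<noteq> {}"
  shows "ehrhart_series P = Abs_fps (\<lambda>k. real (card ((*\<^sub>R) (real k) ` P \<inter> int_lattice)))"
proof (rule fps_ext)
  fix k
  have "(*\<^sub>R) 0 ` P \<inter> int_lattice = {0}" using assms by (auto simp: int_lattice_zero)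
  then show "fps_nth (ehrhart_series P) k =
      fps_nth (Abs_fps (\<lambda>k. real (card ((*\<^sub>R) (real k) ` P \<inter> int_lattice)))) k"
    by (simp add: ehrhart_series_def)
qed

text \<open>The lattice points of the cone over \<open>P\<close> form a module over the monoid of the vertices,
  generated by the points that are left when the coefficients are reduced modulo \<open>D\<close>.\<close>

lemma ehrhart_series_rational:
  fixes V :: "(real ^ 'n) set"
  assumes "finite V" "V \<noteq> {}" and D: "0 < D" and lat: "\<And>v. v \<in> V \<Longrightarrow> real D *\<^sub>R v \<in> int_lattice"
  shows "\<exists>p. ehrhart_series (convex hull V) * (1 - fps_X ^ D) ^ card V = fps_of_poly p"
proof -
  define P where "P = convex hull V"
  have P: "convex P" "P \<noteq> {}" "V \<subseteq> P" "bounded P"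
    using assms by (auto simp: P_def hull_subset finite_imp_bounded_convex_hull)
  define M where "M k = (*\<^sub>R) (real k) ` P \<inter> int_lattice" for k
  have fin: "finite (M k)" for k
    unfolding M_def using P(4) by (intro finite_bounded_Int_int_lattice bounded_scaling)
  obtain vs where vs: "set vs = V" "distinct vs" using finite_distinct_list[OF assms(1)] by blast
  define ws where "ws = map (\<lambda>v. real D *\<^sub>R v) vs"
  have ws: "w \<in> (*\<^sub>R) (real D) ` P" "w \<in> int_lattice" if "w \<in> set ws" for w
    using that lat P(3) by (auto simp: ws_def vs)
  \<comment> \<open>Each of the \<open>card V\<close> remainders is at most \<open>D\<close>, so
    generators of degree at most \<open>D * card V\<close> suffice.\<close>
  define B where "B = (\<Union>j\<le>D * card V. M j \<times> {j})"
  have "finite B" using fin by (auto simp: B_def)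
  then obtain bs where bs: "set bs = B" using finite_list by blast
  have M: "M k = {fst (bs ! c) + nat_comb ws xs |c xs. c < length bs \<and>
                  length xs = length ws \<and> snd (bs ! c) + D * sum_list xs = k}" (is "_ = ?R") for k
  proof (intro equalityI subsetI)
    fix x assume "x \<in> ?R"
    then obtain c xs where *: "x = fst (bs ! c) + nat_comb ws xs" "c < length bs"
      "length xs = length ws" "snd (bs ! c) + D * sum_list xs = k" by blast
    obtain b j where bj: "bs ! c = (b, j)" by fastforce
    then have "b \<in> M j" using bs *(2) nth_mem[of c bs] by (auto simp: B_def)
    moreover have "nat_comb ws xs \<in> (*\<^sub>R) (real D * real (sum_list xs)) ` P"
      "nat_comb ws xs \<in> int_lattice"
      using ws P *(3) by (auto intro: nat_comb_in_scaleR_image nat_comb_in_int_lattice)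
    ultimately have "b + nat_comb ws xs \<in> (*\<^sub>R) (real j + real D * real (sum_list xs)) ` P"
      "b + nat_comb ws xs \<in> int_lattice"
      using P(1) by (auto simp: M_def intro!: scaleR_image_add int_lattice_add)
    then show "x \<in> M k" using * bj by (auto simp: M_def)
  next
    fix x assume x: "x \<in> M k"
    then obtain u where u: "\<And>v. v \<in> V \<Longrightarrow> 0 \<le> u v" "sum u V = 1"
      "x = real k *\<^sub>R (\<Sum>v\<in>V. u v *\<^sub>R v)"
      by (auto simp: M_def P_def convex_hull_finite[OF assms(1)])
    define f where "f v = nat \<lfloor>real k * u v / real D\<rfloor>" for v
    define e where "e v = real k * u v - real D * real (f v)" for v
    have e: "0 \<le> e v" "e v \<le> real D" if "v \<in> V" for v
    proof -
      have "0 \<le> real k * u v / real D" using u(1)[OF that] by simp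
      then have "real (f v) \<le> real k * u v / real D" "real k * u v / real D \<le> real (f v) + 1"
        unfolding f_def by linarith+
      then show "0 \<le> e v" "e v \<le> real D" using D by (simp_all add: e_def field_simps)
    qed
    define xs where "xs = map f vs"
    have sum_xs: "sum_list xs = sum f V" using vs by (simp add: xs_def sum_list_distinct_conv_sum_set)
    have sum_e: "sum e V = real k - real D * real (sum f V)"
      using u(2) by (simp add: e_def sum_subtractf sum_distrib_left[symmetric])
    have "0 \<le> sum e V" using e by (simp add: sum_nonneg)
    then have "real (D * sum f V) \<le> real k" using sum_e by simp
    then have le: "D * sum f V \<le> k" by (simp only: of_nat_le_iff)
    define j where "j = k - D * sum f V"
    have j: "real j = sum e V" "k = j + D * sum f V" using le sum_e by (auto simp: j_def of_nat_diff)
    have "sum e V \<le> (\<Sum>v\<in>V. real D)" using e by (intro sum_mono) auto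
    then have "real j \<le> real (D * card V)" using j(1) by (simp add: mult.commute)
    then have jle: "j \<le> D * card V" by (simp only: of_nat_le_iff)
    define b where "b = x - nat_comb ws xs"
    have comb: "nat_comb ws xs = (\<Sum>v\<in>V. (real D * real (f v)) *\<^sub>R v)"
      unfolding ws_def xs_def using vs nat_comb_map[of vs "\<lambda>v. real D *\<^sub>R v" f]
      by (simp add: mult.commute)
    have "b = (\<Sum>v\<in>V. e v *\<^sub>R v)"
      unfolding b_def comb u(3) e_def by (simp add: scaleR_sum_right sum_subtractf[symmetric] algebra_simps)
    then have "b \<in> (*\<^sub>R) (real j) ` P"
      using scaleR_image_sum[OF P(1,2) assms(1) P(3), of e] e by (simp add: j)
    moreover have "b \<in> int_lattice"
      using x ws by (auto simp: b_def M_def xs_def ws_def intro!: int_lattice_diff nat_comb_in_int_lattice)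
    ultimately have "(b, j) \<in> set bs" using jle by (auto simp: bs B_def M_def)
    then obtain c where "c < length bs" "bs ! c = (b, j)" by (auto simp: in_set_conv_nth)
    then show "x \<in> ?R"
      using j(2) sum_xs by (intro CollectI exI[of _ c] exI[of _ xs]) (auto simp: b_def xs_def ws_def)
  qed
  have "length ws = card V" using vs by (auto simp: ws_def distinct_card)
  then show ?thesis
    using finitely_generated_series[OF D M] ehrhart_series_eq[OF P(2)] by (simp add: M_def P_def)
qed

section \<open>Free sums and special linear matrices\<close>

lemma int_matrix_mult_int_lattice:
  fixes g :: "real ^ 'n ^ 'n"
  assumes "\<And>i j. g $ i $ j \<in> \<int>" "x \<in> int_lattice"
  shows "g *v x \<in> int_lattice"
  using assms by (auto simp: int_lattice_def matrix_vector_mult_def intro!: Ints_sum Ints_mult)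

lemma det_in_Ints:
  fixes A :: "real ^ 'n ^ 'n"
  assumes "\<And>i j. A $ i $ j \<in> \<int>"
  shows "det A \<in> \<int>"
  unfolding det_def using assms by (intro Ints_sum Ints_mult Ints_prod) auto

text \<open>By Cramer's rule the coordinates of \<open>x\<close> are determinants of integer
  matrices divided by \<open>det g = 1\<close>.\<close>

lemma SL_int_reflects_int_lattice:
  assumes g: "g \<in> SL_int" and "g *v x \<in> int_lattice"
  shows "x \<in> int_lattice"
proof -
  have det: "det g = 1" using g by (simp add: SL_int_def)
  then have "x = (\<chi> k. det (\<chi> i j. if j = k then (g *v x) $ i else g $ i $ j) / det g)"
    using cramer[of g x "g *v x"] by simp
  moreover have "det (\<chi> i j. if j = k then (g *v x) $ i else g $ i $ j) \<in> \<int>" for k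
    using assms by (intro det_in_Ints) (auto simp: SL_int_def int_lattice_def)
  ultimately have "x $ k \<in> \<int>" for k
    using det by (metis (no_types, lifting) div_by_1 vec_lambda_beta)
  then show ?thesis by (simp add: int_lattice_def)
qed

lemma span_axis_component:
  fixes x :: "real ^ 'n"
  assumes "x \<in> span ((\<lambda>i. axis i (1::real)) ` I)" "i \<notin> I"
  shows "x $ i = 0"
  using assms(1)
proof (induction rule: span_induct_alt)
  case (step c y z)
  then show ?case using assms(2) by (auto simp: axis_def split: if_splits)
qed simp

lemma dim_span_axis: "dim (span ((\<lambda>i. axis i (1::real)) ` (I :: 'n::finite set))) = card I"
proof -
  have "(\<lambda>i. axis i (1::real)) ` I \<subseteq> (Basis :: (real ^ 'n) set)" by auto
  then have "independent ((\<lambda>i. axis i (1::real)) ` I)"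
    using independent_Basis independent_mono by blast
  then show ?thesis
    by (simp add: dim_eq_card_independent card_image inj_on_def axis_eq_axis)
qed

lemma is_free_sum_commute: "is_free_sum P Q \<Longrightarrow> is_free_sum Q P"
  unfolding is_free_sum_def by (blast intro: orthogonal_commute[THEN iffD1])

lemma is_free_sum_zero:
  assumes "is_free_sum P Q"
  shows "0 \<in> P"
proof -
  obtain g :: "real ^ 'a ^ 'a" where g: "g \<in> SL_int" "0 \<in> (*v) g ` P"
    using assms by (auto simp: is_free_sum_def)
  then obtain x where x: "x \<in> P" "g *v x = 0" by auto
  have "invertible g" using g by (simp add: SL_int_def invertible_det_nz)
  then have "inj ((*v) g)" by (simp add: inj_matrix_vector_mult)
  then have "x = 0" using x(2) by (metis injD matrix_vector_mult_0_right)
  then show ?thesis using x by simp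
qed

text \<open>The projection onto the coordinates in \<open>I\<close>, conjugated by \<open>g\<close>.
  It kills \<open>Q\<close> because the two coordinate subspaces are orthogonal. Being integral, it
  shows that the two components of a lattice point are lattice points.\<close>

lemma is_free_sum_projection:
  fixes P Q :: "(real ^ 'n) set"
  assumes "is_free_sum P Q"
  obtains \<pi> where "linear \<pi>" "\<And>z. z \<in> int_lattice \<Longrightarrow> \<pi> z \<in> int_lattice"
    "\<And>x. x \<in> span P \<Longrightarrow> \<pi> x = x" "\<And>y. y \<in> span Q \<Longrightarrow> \<pi> y = 0"
proof -
  obtain g :: "real ^ 'n ^ 'n" and I where g: "g \<in> SL_int"
    and I: "span ((*v) g ` P) = span ((\<lambda>i. axis i 1) ` I)"
    and orth: "\<And>x y. x \<in> span ((*v) g ` P) \<Longrightarrow> y \<in> span ((*v) g ` Q) \<Longrightarrow> orthogonal x y"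
    using assms unfolding is_free_sum_def coordinate_subspace_def by blast
  have "invertible g" using g by (simp add: SL_int_def invertible_det_nz)
  then obtain h where h: "h ** g = mat 1" "g ** h = mat 1" by (auto simp: invertible_def)
  have gh: "g *v (h *v x) = x" "h *v (g *v x) = x" for x
    by (simp_all add: matrix_vector_mul_assoc h)
  define mask where "mask x = (\<chi> i. if i \<in> I then x $ i else 0)" for x :: "real ^ 'n"
  have "linear mask" by (rule linearI) (auto simp: mask_def vec_eq_iff)
  have span_g: "g *v x \<in> span ((*v) g ` A)" if "x \<in> span A" for x A
    using that linear_span_image[of "(*v) g" A] by (metis image_eqI matrix_vector_mul_linear)
  show thesis
  proof (rule that[of "\<lambda>x. h *v mask (g *v x)"])
    show "linear (\<lambda>x. h *v mask (g *v x))"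
      using linear_compose[OF linear_compose[OF matrix_vector_mul_linear[of g] \<open>linear mask\<close>]
          matrix_vector_mul_linear[of h]] by (simp add: o_def)
    show "h *v mask (g *v z) \<in> int_lattice" if "z \<in> int_lattice" for z
    proof (rule SL_int_reflects_int_lattice[OF g])
      have "g *v z \<in> int_lattice"
        using g that by (intro int_matrix_mult_int_lattice) (auto simp: SL_int_def)
      then show "g *v (h *v mask (g *v z)) \<in> int_lattice" by (auto simp: gh mask_def int_lattice_def)
    qed
    show "h *v mask (g *v x) = x" if "x \<in> span P" for x
    proof -
      have "mask (g *v x) = g *v x"
        using span_axis_component[of "g *v x" I] span_g[OF that] I by (auto simp: mask_def vec_eq_iff)
      then show ?thesis by (simp add: gh)
    qed
    show "h *v mask (g *v y) = 0" if "y \<in> span Q" for y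
    proof -
      have "(g *v y) $ i = 0" if "i \<in> I" for i
      proof -
        have "axis i 1 \<in> span ((*v) g ` P)" unfolding I using that by (intro span_base) auto
        then have "orthogonal (axis i 1) (g *v y)" using orth span_g[OF \<open>y \<in> span Q\<close>] by blast
        then show ?thesis by (simp add: orthogonal_def inner_axis')
      qed
      then have "mask (g *v y) = 0" by (auto simp: mask_def vec_eq_iff)
      then show ?thesis by simp
    qed
  qed
qed

text \<open>In the coordinates given by \<open>g\<close>, the dilate of \<open>P\<close> by
  \<open>k\<close> lies in a box of a coordinate subspace of dimension \<open>dim P\<close>. The
  constant comes from \<open>2 * (k * R) + 1 \<le> (2 * R + 1) * Suc k\<close>.\<close>

lemma is_free_sum_growth:
  fixes P Q :: "(real ^ 'n) set"
  assumes "is_free_sum P Q" "bounded P"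
  obtains C where "0 \<le> C"
    "\<And>k. real (card ((*\<^sub>R) (real k) ` P \<inter> int_lattice)) \<le> C * real (Suc k) ^ dim P"
proof -
  obtain g :: "real ^ 'n ^ 'n" and I where g: "g \<in> SL_int"
    and I: "span ((*v) g ` P) = span ((\<lambda>i. axis i 1) ` I)"
    using assms unfolding is_free_sum_def coordinate_subspace_def by blast
  have "invertible g" using g by (simp add: SL_int_def invertible_det_nz)
  then have inj: "inj ((*v) g)" by (simp add: inj_matrix_vector_mult)
  have "dim ((*v) g ` P) = dim P"
    using inj by (intro dim_image_eq) (auto intro: inj_on_subset)
  then have cI: "card I = dim P" using I dim_span_axis[of I] by (metis dim_span)
  have "bounded ((*v) g ` P)"
    using assms(2) by (intro bounded_linear_image) (auto intro: linear_linear[THEN iffD2])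
  then obtain R' where "\<And>x. x \<in> P \<Longrightarrow> norm (g *v x) \<le> R'" by (auto simp: bounded_iff)
  then obtain R where R: "\<And>x. x \<in> P \<Longrightarrow> norm (g *v x) \<le> real R"
    by (meson order_trans real_arch_simple)
  show thesis
  proof
    show "0 \<le> real ((2 * R + 1) ^ card I)" by simp
    fix k
    let ?M = "(*\<^sub>R) (real k) ` P \<inter> int_lattice"
    let ?B = "{x \<in> int_lattice. (\<forall>i\<in>I. \<bar>x $ i\<bar> \<le> real (k * R)) \<and> (\<forall>i. i \<notin> I \<longrightarrow> x $ i = 0)}"
    have sub: "(*v) g ` ?M \<subseteq> ?B"
    proof
      fix y assume "y \<in> (*v) g ` ?M"
      then obtain x where x: "x \<in> P" "real k *\<^sub>R x \<in> int_lattice" "y = g *v (real k *\<^sub>R x)" by auto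
      have y: "y = real k *\<^sub>R (g *v x)" unfolding x(3) by (simp add: matrix_vector_mult_scaleR)
      have "y \<in> int_lattice"
        unfolding x(3) using g x(2) by (intro int_matrix_mult_int_lattice) (auto simp: SL_int_def)
      moreover have "\<bar>y $ i\<bar> \<le> real (k * R)" for i
      proof -
        have "\<bar>(g *v x) $ i\<bar> \<le> real R" using component_le_norm_cart[of "g *v x" i] R[OF x(1)] by linarith
        then show ?thesis by (simp add: y abs_mult mult_left_mono)
      qed
      moreover have "y $ i = 0" if "i \<notin> I" for i
      proof -
        have "g *v x \<in> span ((\<lambda>i. axis i 1) ` I)" unfolding I[symmetric] using x(1) by (intro span_base) auto
        then show ?thesis using span_axis_component[of "g *v x" I i] that by (simp add: y)
      qed
      ultimately show "y \<in> ?B" by blast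
    qed
    have "card ?M = card ((*v) g ` ?M)"
      using inj by (intro card_image[symmetric]) (auto intro: inj_on_subset)
    also have "\<dots> \<le> card ?B" using sub card_int_lattice_box(1) by (rule card_mono[rotated])
    also have "\<dots> \<le> (2 * (k * R) + 1) ^ card I" by (rule card_int_lattice_box(2))
    also have "\<dots> \<le> ((2 * R + 1) * Suc k) ^ card I" by (intro power_mono) auto
    finally have "card ?M \<le> (2 * R + 1) ^ card I * Suc k ^ dim P"
      by (simp add: power_mult_distrib cI del: mult_Suc mult_Suc_right)
    then show "real (card ?M) \<le> real ((2 * R + 1) ^ card I) * real (Suc k) ^ dim P"
      by (metis of_nat_le_iff of_nat_mult of_nat_power)
  qed
qed

section \<open>Denominators and delta polynomials\<close>

lemma extreme_point_of_scaleR_image: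
  fixes P :: "'a::real_vector set"
  assumes "c \<noteq> 0"
  shows "c *\<^sub>R v extreme_point_of (*\<^sub>R) c ` P \<longleftrightarrow> v extreme_point_of P"
proof -
  have "linear ((*\<^sub>R) c :: 'a \<Rightarrow> 'a)" by simp
  then show ?thesis
    using face_of_linear_image[of "(*\<^sub>R) c" "{v}" P] assms
    by (simp add: face_of_singleton inj_on_def)
qed

lemma lattice_polytope_scaled_iff:
  assumes "polytope P" "0 < d"
  shows "lattice_polytope ((*\<^sub>R) (real d) ` P) \<longleftrightarrow>
         (\<forall>v. v extreme_point_of P \<longrightarrow> real d *\<^sub>R v \<in> int_lattice)"
proof -
  have "w extreme_point_of (*\<^sub>R) (real d) ` P \<longleftrightarrow> (\<exists>v. w = real d *\<^sub>R v \<and> v extreme_point_of P)" for w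
  proof -
    have "w = real d *\<^sub>R ((1 / real d) *\<^sub>R w)" using assms(2) by simp
    then show ?thesis using extreme_point_of_scaleR_image[of "real d" _ P] assms(2)
      by (metis of_nat_0_less_iff less_irrefl)
  qed
  then show ?thesis
    using polytope_scaling[OF assms(1), of "real d"] unfolding lattice_polytope_def by auto
qed

lemma rational_common_denominator:
  assumes "finite S" "S \<subseteq> \<rat>"
  shows "\<exists>n>0. \<forall>q\<in>S. real n * q \<in> \<int>"
  using assms
proof (induction rule: finite_induct)
  case (insert q S)
  then obtain n where n: "0 < n" "\<forall>q\<in>S. real n * q \<in> \<int>" by auto
  from insert obtain a b where q: "q = of_int a / of_int b" "b > 0" by (auto elim: Rats_cases')
  have "real (n * nat b) * x \<in> \<int>" if "x \<in> insert q S" for x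
  proof (cases "x = q")
    case True
    have "real (n * nat b) * q = of_int (int n * a)" using q by simp
    then show ?thesis using True by (metis Ints_of_int)
  next
    case False
    then have "real n * x \<in> \<int>" using n that by auto
    then have "real (nat b) * (real n * x) \<in> \<int>" by (rule Ints_mult[OF Ints_of_nat])
    then show ?thesis by (simp only: of_nat_mult mult_ac)
  qed
  then show ?case using n(1) q(2) by (intro exI[of _ "n * nat b"]) auto
qed auto

lemma rational_polytope_multiple:
  fixes P :: "(real ^ 'n) set"
  assumes "rational_polytope P"
  shows "\<exists>d>0. lattice_polytope ((*\<^sub>R) (real d) ` P)"
proof -
  have P: "polytope P" using assms by (simp add: rational_polytope_def)
  define S where "S = (\<lambda>(v, i). v $ i) ` ({v. v extreme_point_of P} \<times> (UNIV :: 'n set))"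
  have "finite S"
    unfolding S_def using finite_polyhedron_extreme_points[OF polytope_imp_polyhedron[OF P]] by simp
  moreover have "S \<subseteq> \<rat>" using assms by (auto simp: S_def rational_polytope_def)
  ultimately obtain n where n: "n > 0" "\<forall>q\<in>S. real n * q \<in> \<int>"
    using rational_common_denominator by blast
  have "real n *\<^sub>R v \<in> int_lattice" if "v extreme_point_of P" for v
    using n(2) that by (force simp: int_lattice_def S_def)
  then show ?thesis using n(1) lattice_polytope_scaled_iff[OF P n(1)] by blast
qed

lemma
  assumes "rational_polytope P"
  shows denominator_pos: "0 < denominator P"
    and denominator_lattice: "lattice_polytope ((*\<^sub>R) (real (denominator P)) ` P)"
  using LeastI_ex[OF rational_polytope_multiple[OF assms]] by (auto simp: denominator_def)

text \<open>The integers that carry all vertices to lattice points form a subgroup, generated by its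
  least positive element.\<close>

lemma denominator_dvd_iff:
  assumes R: "rational_polytope P" and "0 < d"
  shows "lattice_polytope ((*\<^sub>R) (real d) ` P) \<longleftrightarrow> denominator P dvd d"
proof -
  have P: "polytope P" using R by (simp add: rational_polytope_def)
  let ?D = "denominator P"
  have D: "real ?D *\<^sub>R v \<in> int_lattice" if "v extreme_point_of P" for v
    using that denominator_lattice[OF R] lattice_polytope_scaled_iff[OF P denominator_pos[OF R]] by blast
  show ?thesis
  proof
    assume "?D dvd d"
    then obtain m where m: "d = m * ?D" by (metis dvdE mult.commute)
    have "real d *\<^sub>R v \<in> int_lattice" if "v extreme_point_of P" for v
      using int_lattice_of_nat[OF D[OF that], of m] by (simp add: m)
    then show "lattice_polytope ((*\<^sub>R) (real d) ` P)"
      using lattice_polytope_scaled_iff[OF P \<open>0 < d\<close>] by blast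
  next
    assume L: "lattice_polytope ((*\<^sub>R) (real d) ` P)"
    define r where "r = d mod ?D"
    have "real r *\<^sub>R v \<in> int_lattice" if "v extreme_point_of P" for v
    proof -
      have "real d *\<^sub>R v \<in> int_lattice"
        using L that lattice_polytope_scaled_iff[OF P \<open>0 < d\<close>] by blast
      moreover have "real d = real (d div ?D) * real ?D + real r"
        unfolding r_def by (metis div_mult_mod_eq of_nat_add of_nat_mult)
      then have "real r *\<^sub>R v = real d *\<^sub>R v - real (d div ?D) *\<^sub>R real ?D *\<^sub>R v"
        by (simp add: algebra_simps)
      ultimately show ?thesis using D[OF that] by (simp add: int_lattice_diff int_lattice_of_nat del: scaleR_scaleR)
    qed
    then have "?D \<le> r" if "0 < r"
      unfolding denominator_def using that lattice_polytope_scaled_iff[OF P that]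
      by (intro Least_le) blast
    moreover have "r < ?D" using denominator_pos[OF R] by (simp add: r_def)
    ultimately have "r = 0" by linarith
    then show "?D dvd d" by (simp add: r_def dvd_eq_mod_eq_0)
  qed
qed

lemma denominator_lattice_polytope:
  assumes "lattice_polytope P"
  shows "denominator P = 1"
  unfolding denominator_def by (rule Least_equality) (use assms in auto)

lemma fps_one_minus_X_power_nth_0: "0 < D \<Longrightarrow> fps_nth ((1 - fps_X ^ D) ^ m :: real fps) 0 = 1"
  by (simp add: fps_power_zeroth power_0_left)

lemma fps_eq_divide_iff:
  fixes F :: "real fps"
  assumes "fps_nth U 0 \<noteq> 0"
  shows "F = G / U \<longleftrightarrow> F * U = G"
  using assms by (auto simp: fps_divide_unit inverse_mult_eq_1 mult.assoc inverse_mult_eq_1')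

text \<open>Replaces the definite description by an equation. A numerator exists by rationality
  together with the growth bound, and it is unique because the denominator has constant term 1.
  Since \<open>0 \<in> P\<close>, affine and linear dimension coincide.\<close>

lemma delta_poly_eq:
  fixes P :: "(real ^ 'n) set"
  assumes R: "rational_polytope P" and "0 \<in> P" "0 \<le> C"
    and growth: "\<And>k. real (card ((*\<^sub>R) (real k) ` P \<inter> int_lattice)) \<le> C * real (Suc k) ^ dim P"
  shows "fps_of_poly (delta_poly P) =
         ehrhart_series P * (1 - fps_X ^ denominator P) ^ (nat (aff_dim P) + 1)"
proof -
  have P: "polytope P" using R by (simp add: rational_polytope_def)
  let ?D = "denominator P"
  define V where "V = {v. v extreme_point_of P}"
  have conv: "P = convex hull V"
    unfolding V_def using P by (intro Krein_Milman_Minkowski polytope_imp_compact polytope_imp_convex)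
  have V: "finite V" "V \<noteq> {}"
  proof -
    show "finite V"
      using finite_polyhedron_extreme_points[OF polytope_imp_polyhedron[OF P]] by (simp add: V_def)
    show "V \<noteq> {}" using conv \<open>0 \<in> P\<close> by (metis convex_hull_empty empty_iff)
  qed
  have "real ?D *\<^sub>R v \<in> int_lattice" if "v \<in> V" for v
    using that denominator_lattice[OF R] lattice_polytope_scaled_iff[OF P denominator_pos[OF R]]
    by (auto simp: V_def)
  then obtain p where p: "ehrhart_series P * (1 - fps_X ^ ?D) ^ card V = fps_of_poly p"
    using ehrhart_series_rational[OF V denominator_pos[OF R]] conv by metis
  have "\<bar>fps_nth (ehrhart_series P) k\<bar> \<le> C * real (Suc k) ^ dim P" for k
    using growth[of k] \<open>0 \<in> P\<close> by (subst ehrhart_series_eq) auto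
  then obtain q where q: "ehrhart_series P * (1 - fps_X ^ ?D) ^ Suc (dim P) = fps_of_poly q"
    using polynomial_growth_reduces_exponent[OF denominator_pos[OF R] _ p] by blast
  have dim: "nat (aff_dim P) + 1 = Suc (dim P)"
    using aff_dim_zero[OF hull_inc[OF \<open>0 \<in> P\<close>]] by simp
  have "ehrhart_series P = fps_of_poly r / (1 - fps_X ^ ?D) ^ (nat (aff_dim P) + 1) \<longleftrightarrow> r = q" for r
  proof (subst fps_eq_divide_iff)
    show "fps_nth ((1 - fps_X ^ ?D) ^ (nat (aff_dim P) + 1) :: real fps) 0 \<noteq> 0"
      by (simp only: fps_one_minus_X_power_nth_0[OF denominator_pos[OF R]])
    show "ehrhart_series P * (1 - fps_X ^ ?D) ^ (nat (aff_dim P) + 1) = fps_of_poly r \<longleftrightarrow> r = q"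
      unfolding dim q by auto
  qed
  then have "delta_poly P = q" by (simp only: delta_poly_def the_eq_trivial)
  then show ?thesis unfolding dim q by simp
qed

section \<open>Dilates, vertices and dimension of the free sum\<close>

lemma scaleR_conv_union_iff:
  assumes "convex P" "P \<noteq> {}" "convex Q" "Q \<noteq> {}" "0 \<le> c"
  shows "z \<in> (*\<^sub>R) c ` conv_union P Q \<longleftrightarrow>
    (\<exists>a b x y. 0 \<le> a \<and> 0 \<le> b \<and> a + b = c \<and> x \<in> (*\<^sub>R) a ` P \<and> y \<in> (*\<^sub>R) b ` Q \<and> z = x + y)"
    (is "?L \<longleftrightarrow> ?R")
proof
  assume ?L
  then obtain u v s t where *: "0 \<le> u" "0 \<le> v" "u + v = 1" "s \<in> P" "t \<in> Q"
    "z = c *\<^sub>R (u *\<^sub>R s + v *\<^sub>R t)"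
    unfolding conv_union_def convex_hull_union_two[OF assms(1-4)] by blast
  have "c * u + c * v = c" using *(3) by (metis distrib_left mult.right_neutral)
  moreover have "z = (c * u) *\<^sub>R s + (c * v) *\<^sub>R t" using * by (simp add: scaleR_add_right)
  ultimately show ?R using * assms(5)
    by (intro exI[of _ "c * u"] exI[of _ "c * v"] exI[of _ "(c * u) *\<^sub>R s"] exI[of _ "(c * v) *\<^sub>R t"]) auto
next
  assume ?R
  then obtain a b x y where "0 \<le> a" "0 \<le> b" "a + b = c" "x \<in> (*\<^sub>R) a ` P" "y \<in> (*\<^sub>R) b ` Q" "z = x + y"
    by blast
  moreover have "P \<subseteq> conv_union P Q" "Q \<subseteq> conv_union P Q"
    using hull_subset[of "P \<union> Q" convex] by (auto simp: conv_union_def)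
  moreover have "convex (conv_union P Q)" by (simp add: conv_union_def)
  ultimately show ?L using scaleR_image_add[of "conv_union P Q" a b x y] by blast
qed

text \<open>Stating the splitting through a projection makes the setting symmetric: exchanging
  \<open>P\<close> and \<open>Q\<close> replaces \<open>\<pi>\<close> by the complementary
  projection.\<close>

locale free_sum =
  fixes P Q :: "(real ^ 'n) set" and \<pi> :: "real ^ 'n \<Rightarrow> real ^ 'n"
  assumes rat_P: "rational_polytope P" and rat_Q: "rational_polytope Q"
    and zero_P: "0 \<in> P" and zero_Q: "0 \<in> Q"
    and lin: "linear \<pi>" and int: "\<And>z. z \<in> int_lattice \<Longrightarrow> \<pi> z \<in> int_lattice"
    and on_P: "\<And>x. x \<in> span P \<Longrightarrow> \<pi> x = x" and on_Q: "\<And>y. y \<in> span Q \<Longrightarrow> \<pi> y = 0"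
begin

lemma poly_P: "polytope P" and poly_Q: "polytope Q"
  using rat_P rat_Q by (simp_all add: rational_polytope_def)

lemmas conv_P = polytope_imp_convex[OF poly_P] and conv_Q = polytope_imp_convex[OF poly_Q]

lemma subset_conv_union: "P \<subseteq> conv_union P Q" "Q \<subseteq> conv_union P Q"
  using hull_subset[of "P \<union> Q" convex] by (auto simp: conv_union_def)

lemma polytope_conv_union: "polytope (conv_union P Q)"
proof -
  obtain V W where "finite V" "P = convex hull V" "finite W" "Q = convex hull W"
    using poly_P poly_Q unfolding polytope_def by blast
  then have "conv_union P Q = convex hull (V \<union> W)" unfolding conv_union_def by (metis hull_Un_left hull_Un_right)
  then show ?thesis using \<open>finite V\<close> \<open>finite W\<close> unfolding polytope_def by blast
qed

lemma extreme_point_of_conv_union: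
  assumes "v extreme_point_of conv_union P Q"
  shows "v extreme_point_of P \<or> v extreme_point_of Q"
proof -
  have "v \<in> P \<union> Q" using assms extreme_point_of_convex_hull unfolding conv_union_def by blast
  then show ?thesis using assms subset_conv_union unfolding extreme_point_of_def by blast
qed

lemma rational_conv_union: "rational_polytope (conv_union P Q)"
  using polytope_conv_union extreme_point_of_conv_union rat_P rat_Q
  by (auto simp: rational_polytope_def)

lemma projection_conv_union: "\<pi> ` conv_union P Q = P"
proof -
  have "\<pi> ` (P \<union> Q) = P"
  proof -
    have "\<pi> ` P = P" using on_P[OF span_base] by simp
    moreover have "\<pi> ` Q \<subseteq> P" using on_Q[OF span_base] zero_P by auto
    ultimately show ?thesis by blast
  qed
  then have "\<pi> ` conv_union P Q = convex hull P"
    unfolding conv_union_def by (simp add: convex_hull_linear_image[OF lin])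
  then show ?thesis using conv_P by (simp add: hull_same)
qed

text \<open>A vertex of \<open>P\<close> need not be a vertex of the sum: the origin may be a vertex
  of \<open>P\<close> and an inner point of \<open>Q\<close>. Being the projection of a vertex is
  enough to transfer integrality.\<close>

lemma extreme_point_of_P:
  assumes "v extreme_point_of P"
  obtains w where "w extreme_point_of conv_union P Q" "v = \<pi> w"
proof -
  have "conv_union P Q = convex hull {w. w extreme_point_of conv_union P Q}"
    using polytope_conv_union
    by (intro Krein_Milman_Minkowski polytope_imp_compact polytope_imp_convex)
  then have "P = convex hull (\<pi> ` {w. w extreme_point_of conv_union P Q})"
    using projection_conv_union convex_hull_linear_image[OF lin] by metis
  then have "v \<in> \<pi> ` {w. w extreme_point_of conv_union P Q}"
    using assms extreme_point_of_convex_hull by metis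
  then show thesis using that by blast
qed

lemma lattice_scaled_conv_union_imp:
  assumes "0 < d" "lattice_polytope ((*\<^sub>R) (real d) ` conv_union P Q)"
  shows "lattice_polytope ((*\<^sub>R) (real d) ` P)"
  unfolding lattice_polytope_scaled_iff[OF poly_P assms(1)]
proof (intro allI impI)
  fix v assume "v extreme_point_of P"
  then obtain w where w: "w extreme_point_of conv_union P Q" "v = \<pi> w" by (rule extreme_point_of_P)
  then have "\<pi> (real d *\<^sub>R w) \<in> int_lattice"
    using assms lattice_polytope_scaled_iff[OF polytope_conv_union assms(1)] int by blast
  then show "real d *\<^sub>R v \<in> int_lattice" using w(2) linear_scale[OF lin] by simp
qed

lemma span_Int: "span P \<inter> span Q = {0}"
  using on_P on_Q by (auto simp: span_zero) metis

lemma dim_conv_union: "dim (conv_union P Q) = dim P + dim Q"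
proof -
  have 0: "0 \<in> affine hull (P \<union> Q)" using zero_P by (simp add: hull_inc)
  have "int (dim (conv_union P Q)) = aff_dim (conv_union P Q)"
    using zero_P subset_conv_union by (intro aff_dim_zero[symmetric] hull_inc) auto
  also have "\<dots> = int (dim (P \<union> Q))"
    unfolding conv_union_def using aff_dim_zero[OF 0] by (simp add: aff_dim_convex_hull)
  also have "dim (P \<union> Q) = dim {x + y |x y. x \<in> span P \<and> y \<in> span Q}"
  proof -
    have "span (P \<union> Q) = {x + y |x y. x \<in> span P \<and> y \<in> span Q}" by (auto simp: span_Un)
    then show ?thesis by (metis dim_span)
  qed
  also have "\<dots> = dim P + dim Q"
    using dim_sums_Int[of "span P" "span Q"] by (simp add: span_Int)
  finally show ?thesis by simp
qed

lemma aff_dim_sum: "nat (aff_dim P) = dim P" "nat (aff_dim Q) = dim Q"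
  "nat (aff_dim (conv_union P Q)) = dim P + dim Q"
  using aff_dim_zero[OF hull_inc[OF zero_P]] aff_dim_zero[OF hull_inc[OF zero_Q]]
    aff_dim_zero[OF hull_inc, of "conv_union P Q"] zero_P subset_conv_union dim_conv_union
  by auto

end

section \<open>The gauge and the vertices of the dual\<close>

text \<open>Only meaningful on the cone over \<open>P\<close>: elsewhere the infimum is over the empty set.\<close>

definition minkowski_gauge :: "'a::real_vector set \<Rightarrow> 'a \<Rightarrow> real" where
  "minkowski_gauge P x = Inf {c. 0 \<le> c \<and> x \<in> (*\<^sub>R) c ` P}"

definition lattice_cone :: "(real ^ 'n) set \<Rightarrow> (real ^ 'n) set" where
  "lattice_cone P = {x \<in> int_lattice. \<exists>c\<ge>0. x \<in> (*\<^sub>R) c ` P}"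

text \<open>The admissible factors up to \<open>c0\<close> form the projection of a compact set, so
  the infimum is a minimum. All larger factors are admissible because
  \<open>0 \<in> P\<close>.\<close>

lemma minkowski_gauge:
  fixes P :: "'a::euclidean_space set"
  assumes P: "compact P" "convex P" "0 \<in> P" and x: "0 \<le> c0" "x \<in> (*\<^sub>R) c0 ` P"
  shows minkowski_gauge_nonneg: "0 \<le> minkowski_gauge P x"
    and minkowski_gauge_attained: "x \<in> (*\<^sub>R) (minkowski_gauge P x) ` P"
    and minkowski_gauge_le_iff: "0 \<le> c \<Longrightarrow> minkowski_gauge P x \<le> c \<longleftrightarrow> x \<in> (*\<^sub>R) c ` P"
proof -
  define K where "K = ({0..c0} \<times> P) \<inter> {z. fst z *\<^sub>R snd z = x}"
  have "closed {z :: real \<times> 'a. fst z *\<^sub>R snd z = x}"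
    by (intro closed_Collect_eq continuous_intros)
  then have "compact K"
    unfolding K_def using P(1) by (intro compact_Int_closed compact_Times) auto
  then have cpt: "compact (fst ` K)" by (intro compact_continuous_image continuous_intros)
  obtain p where "p \<in> P" "x = c0 *\<^sub>R p" using x(2) by blast
  then have "(c0, p) \<in> K" using x(1) by (simp add: K_def)
  then have "fst ` K \<noteq> {}" by blast
  then obtain m where m: "m \<in> fst ` K" "\<And>c. c \<in> fst ` K \<Longrightarrow> m \<le> c"
    using compact_attains_inf[OF cpt] by blast
  have in_K: "c \<in> fst ` K \<longleftrightarrow> 0 \<le> c \<and> c \<le> c0 \<and> x \<in> (*\<^sub>R) c ` P" for c
    by (force simp: K_def image_iff)
  have mx: "0 \<le> m" "m \<le> c0" "x \<in> (*\<^sub>R) m ` P" using m(1) in_K by auto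
  have min: "m \<le> c" if "0 \<le> c" "x \<in> (*\<^sub>R) c ` P" for c
    using that m(2)[of c] mx(2) in_K[of c] by (cases "c \<le> c0") auto
  have eq: "minkowski_gauge P x = m"
    unfolding minkowski_gauge_def using mx min by (intro cInf_eq_minimum) auto
  show "0 \<le> minkowski_gauge P x" "x \<in> (*\<^sub>R) (minkowski_gauge P x) ` P" using mx eq by auto
  show "minkowski_gauge P x \<le> c \<longleftrightarrow> x \<in> (*\<^sub>R) c ` P" if "0 \<le> c"
    using that min[of c] scaleR_image_mono[OF P(2,3) mx(1), of c] mx(3) eq by auto
qed

lemma minkowski_gauge_scaleR:
  fixes P :: "'a::euclidean_space set"
  assumes P: "compact P" "convex P" "0 \<in> P" and x: "0 \<le> c0" "x \<in> (*\<^sub>R) c0 ` P" and t: "0 < t"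
  shows "minkowski_gauge P (t *\<^sub>R x) = t * minkowski_gauge P x"
proof (rule antisym)
  have tx: "t *\<^sub>R x \<in> (*\<^sub>R) (t * c0) ` P" "0 \<le> t * c0" using x t by auto
  note g = minkowski_gauge_nonneg[OF P x] minkowski_gauge_attained[OF P x]
  note tg = minkowski_gauge_nonneg[OF P tx(2,1)] minkowski_gauge_attained[OF P tx(2,1)]
  obtain q where "q \<in> P" "x = minkowski_gauge P x *\<^sub>R q" using g(2) by blast
  then have "t *\<^sub>R x = (t * minkowski_gauge P x) *\<^sub>R q" by (metis scaleR_scaleR)
  then have "t *\<^sub>R x \<in> (*\<^sub>R) (t * minkowski_gauge P x) ` P" using \<open>q \<in> P\<close> by blast
  then show "minkowski_gauge P (t *\<^sub>R x) \<le> t * minkowski_gauge P x"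
    using minkowski_gauge_le_iff[OF P tx(2,1), of "t * minkowski_gauge P x"] g(1) t by simp
  obtain p where p: "p \<in> P" "t *\<^sub>R x = minkowski_gauge P (t *\<^sub>R x) *\<^sub>R p" using tg(2) by blast
  have "x = (1 / t) *\<^sub>R (t *\<^sub>R x)" using t by simp
  also have "\<dots> = (minkowski_gauge P (t *\<^sub>R x) / t) *\<^sub>R p" by (subst p(2)) simp
  finally have "x \<in> (*\<^sub>R) (minkowski_gauge P (t *\<^sub>R x) / t) ` P" using p(1) by blast
  then have "minkowski_gauge P x \<le> minkowski_gauge P (t *\<^sub>R x) / t"
    using minkowski_gauge_le_iff[OF P x] tg(1) t by simp
  then show "t * minkowski_gauge P x \<le> minkowski_gauge P (t *\<^sub>R x)" using t by (simp add: field_simps)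
qed

lemma dual_space_eqI:
  assumes "\<phi> \<in> dual_space (span P)" "\<psi> \<in> dual_space (span P)" "span C = span P"
    and "\<And>x. x \<in> C \<Longrightarrow> blinfun_apply \<phi> x = blinfun_apply \<psi> x"
  shows "\<phi> = \<psi>"
proof -
  have eq: "blinfun_apply \<phi> x = blinfun_apply \<psi> x" if "x \<in> span P" for x
  proof -
    have "x \<in> span C" using that assms(3) by simp
    then show ?thesis
      by (rule linear_eq_on[OF bounded_linear.linear[OF blinfun.bounded_linear_right]
            bounded_linear.linear[OF blinfun.bounded_linear_right] _ assms(4)])
  qed
  have "\<exists>!\<rho>. \<rho> \<in> dual_space (span P) \<and> (\<forall>x\<in>span P. blinfun_apply \<rho> x = blinfun_apply \<phi> x)"
    by (intro dual_space_represents) (auto simp: blinfun.add_right blinfun.scaleR_right)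
  then show ?thesis using assms(1,2) eq by metis
qed

lemma inner_in_dual_space:
  assumes "w \<in> span P"
  shows "blinfun_inner_left w \<in> dual_space (span P)"
  using assms by (auto simp: dual_space_def orthogonal_comp_def orthogonal_def inner_commute)

text \<open>On the cone over \<open>P\<close> the gauge is attained by one of the functionals that define the facets
  away from the origin, and these functionals are vertices of the dual.\<close>

lemma minkowski_gauge_eq_dual_vertex:
  fixes P :: "(real ^ 'n) set"
  assumes P: "polytope P" "0 \<in> P" and x: "0 \<le> c0" "x \<in> (*\<^sub>R) c0 ` P" "x \<noteq> 0"
  obtains \<phi> where "\<phi> extreme_point_of dual_polyhedron P" "blinfun_apply \<phi> x = minkowski_gauge P x"
proof -
  have P': "compact P" "convex P" "0 \<in> P"
    using P by (auto simp: polytope_imp_compact polytope_imp_convex)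
  define L where "L = span P"
  have aff: "affine hull P = L"
    unfolding L_def using P(2) by (intro affine_hull_span_0 hull_inc)
  \<comment> \<open>The parallel form puts the normals into the span of \<open>P\<close>, so that
    they represent functionals on it; minimality makes every half-space define a facet.\<close>
  obtain F where F: "finite F" "P = affine hull P \<inter> \<Inter>F"
    "\<forall>h\<in>F. \<exists>a b. a \<noteq> 0 \<and> h = {x. a \<bullet> x \<le> b} \<and> (\<forall>x\<in>affine hull P. x + a \<in> affine hull P)"
    "\<forall>F'. F' \<subset> F \<longrightarrow> P \<subset> affine hull P \<inter> \<Inter>F'"
    using polytope_imp_polyhedron[OF P(1)] unfolding polyhedron_Int_affine_parallel_minimal by blast
  from F(3) obtain a b where ab: "\<And>h. h \<in> F \<Longrightarrow> a h \<noteq> 0 \<and> h = {x. a h \<bullet> x \<le> b h}"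
    "\<And>h x. h \<in> F \<Longrightarrow> x \<in> L \<Longrightarrow> x + a h \<in> L"
    unfolding aff by metis
  have aL: "a h \<in> L" if "h \<in> F" for h
    using ab(2)[OF that, of 0] by (simp add: L_def span_zero)
  have mem: "p \<in> P \<longleftrightarrow> p \<in> L \<and> (\<forall>h\<in>F. a h \<bullet> p \<le> b h)" for p
  proof -
    have "p \<in> P \<longleftrightarrow> p \<in> L \<and> (\<forall>h\<in>F. p \<in> h)" by (subst F(2)) (auto simp: aff)
    also have "(\<forall>h\<in>F. p \<in> h) \<longleftrightarrow> (\<forall>h\<in>F. a h \<bullet> p \<le> b h)" using ab(1) by blast
    finally show ?thesis .
  qed
  have b0: "0 \<le> b h" if "h \<in> F" for h using mem[of 0] P(2) that by auto
  define c where "c = minkowski_gauge P x"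
  note g = minkowski_gauge_nonneg[OF P' x(1,2)] minkowski_gauge_attained[OF P' x(1,2)]
  obtain p where p: "p \<in> P" "x = c *\<^sub>R p" using g(2) by (auto simp: c_def)
  have "c \<noteq> 0" using p(2) x(3) by (metis scaleR_zero_left)
  then have "0 < c" using g(1) unfolding c_def by linarith
  \<comment> \<open>If all facets off the origin were slack at \<open>x\<close>, a factor smaller
    than \<open>c\<close> would do.\<close>
  have "\<exists>h\<in>F. 0 < b h \<and> a h \<bullet> x = c * b h"
  proof (rule ccontr)
    assume neg: "\<not> ?thesis"
    have lt: "a h \<bullet> x / b h < c" if "h \<in> F" "0 < b h" for h
    proof -
      have "a h \<bullet> x \<le> c * b h" using p mem[of p] that \<open>0 < c\<close> by (simp add: mult_left_mono)
      then show ?thesis using neg that by (auto simp: field_simps less_le)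
    qed
    \<comment> \<open>The element \<open>c / 2\<close> keeps the maximum positive, and the set
      nonempty when no \<open>b h\<close> is positive.\<close>
    define A where "A = insert (c / 2) ((\<lambda>h. a h \<bullet> x / b h) ` {h \<in> F. 0 < b h})"
    define c' where "c' = Max A"
    have A: "finite A" "A \<noteq> {}" using F(1) by (auto simp: A_def)
    have c': "c' < c" unfolding c'_def using A lt \<open>0 < c\<close> by (subst Max_less_iff) (auto simp: A_def)
    have "c / 2 \<le> c'" unfolding c'_def using A by (intro Max_ge) (auto simp: A_def)
    then have "0 < c'" using \<open>0 < c\<close> by simp
    have "(1 / c') *\<^sub>R x \<in> P"
      unfolding mem
    proof (intro conjI ballI)
      show "(1 / c') *\<^sub>R x \<in> L"
        using p mem[of p] by (auto simp: L_def intro!: span_scale)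
      fix h assume h: "h \<in> F"
      show "a h \<bullet> ((1 / c') *\<^sub>R x) \<le> b h"
      proof (cases "0 < b h")
        case True
        then have "a h \<bullet> x / b h \<le> c'" unfolding c'_def using A h by (intro Max_ge) (auto simp: A_def)
        then show ?thesis using True \<open>0 < c'\<close> by (simp add: field_simps)
      next
        \<comment> \<open>A half-space with the origin on its boundary is preserved by positive
          scaling.\<close>
        case False
        then have "b h = 0" using b0[OF h] by simp
        then have "a h \<bullet> p \<le> 0" using p(1) mem[of p] h by auto
        then show ?thesis using \<open>b h = 0\<close> \<open>0 < c\<close> \<open>0 < c'\<close> p(2)
          by (simp add: divide_le_0_iff mult_le_0_iff)
      qed
    qed
    then have "x \<in> (*\<^sub>R) c' ` P" using \<open>0 < c'\<close> by (intro image_eqI[of _ _ "(1 / c') *\<^sub>R x"]) auto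
    then have "c \<le> c'" using minkowski_gauge_le_iff[OF P' x(1,2), of c'] \<open>0 < c'\<close> by (simp add: c_def)
    then show False using c' by simp
  qed
  then obtain h where h: "h \<in> F" "0 < b h" "a h \<bullet> x = c * b h" by blast
  define \<phi> where "\<phi> = blinfun_inner_left ((1 / b h) *\<^sub>R a h)"
  have \<phi>: "blinfun_apply \<phi> y = a h \<bullet> y / b h" for y
    by (simp add: \<phi>_def inner_commute)
  have \<phi>_dual: "\<phi> \<in> dual_space (span P)"
    unfolding \<phi>_def using aL[OF h(1)] by (intro inner_in_dual_space span_scale) (simp add: L_def)
  have \<phi>_P: "\<phi> \<in> dual_polyhedron P"
    using \<phi>_dual mem h by (auto simp: dual_polyhedron_def \<phi>)
  define C where "C = P \<inter> {x. a h \<bullet> x = b h}"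
  have "C facet_of P"
    using facet_of_polyhedron_explicit[OF F(1,2) ab(1), of C] F(4) h(1) C_def by blast
  then have dimC: "aff_dim C = aff_dim P - 1" by (simp add: facet_of_def)
  have "C \<subseteq> {y. a h \<bullet> y = b h}" by (auto simp: C_def)
  then have "affine hull C \<subseteq> {y. a h \<bullet> y = b h}"
    by (intro hull_minimal affine_hyperplane)
  then have "0 \<notin> affine hull C" using h(2) by auto
  \<comment> \<open>A facet whose affine hull misses the origin spans the whole of
    \<open>span P\<close>, so a functional is determined by its values on it.\<close>
  then have "aff_dim (insert 0 C) = aff_dim P" using dimC by (simp add: aff_dim_insert)
  then have "dim (insert 0 C) = dim P"
    using aff_dim_zero[OF hull_inc[OF P(2)]] aff_dim_zero[of "insert 0 C"] by (simp add: hull_inc)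
  then have "dim C = dim P" by (metis dim_span span_insert_0)
  then have spanC: "span C = span P"
    by (intro dim_eq_span) (auto simp: C_def)
  have "\<phi> extreme_point_of dual_polyhedron P"
    unfolding extreme_point_of_def
  proof (intro conjI ballI notI \<phi>_P)
    fix \<psi>1 \<psi>2 assume \<psi>: "\<psi>1 \<in> dual_polyhedron P" "\<psi>2 \<in> dual_polyhedron P" "\<phi> \<in> open_segment \<psi>1 \<psi>2"
    then obtain u where u: "0 < u" "u < 1" "\<phi> = (1 - u) *\<^sub>R \<psi>1 + u *\<^sub>R \<psi>2" and "\<psi>1 \<noteq> \<psi>2"
      by (auto simp: in_segment)
    \<comment> \<open>A proper average of two values at most 1 is 1 only if both of them
      are.\<close>
    have "blinfun_apply \<psi>1 y = blinfun_apply \<psi>2 y" if "y \<in> C" for y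
    proof -
      have "blinfun_apply \<phi> y = 1" using that h(2) by (simp add: C_def \<phi>)
      then have "(1 - u) * blinfun_apply \<psi>1 y + u * blinfun_apply \<psi>2 y = 1"
        by (simp add: u(3) blinfun.add_left blinfun.scaleR_left)
      then have "(1 - u) * (1 - blinfun_apply \<psi>1 y) + u * (1 - blinfun_apply \<psi>2 y) = 0"
        by (simp add: algebra_simps)
      moreover have "0 \<le> 1 - blinfun_apply \<psi>1 y" "0 \<le> 1 - blinfun_apply \<psi>2 y"
        using \<psi> that by (auto simp: dual_polyhedron_def C_def)
      ultimately show ?thesis
        using u(1,2) by (subst (asm) add_nonneg_eq_0_iff) auto
    qed
    then have "\<psi>1 = \<psi>2" using \<psi>(1,2) spanC by (intro dual_space_eqI[of \<psi>1 P \<psi>2 C]) (auto simp: dual_polyhedron_def)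
    then show False using \<open>\<psi>1 \<noteq> \<psi>2\<close> by simp
  qed
  moreover have "blinfun_apply \<phi> x = c" using h by (simp add: \<phi>)
  ultimately show thesis using that by (simp add: c_def)
qed

text \<open>The vertices of \<open>P\<close> that are tight at a vertex of the dual span the same space as \<open>P\<close>;
  otherwise the vertex of the dual could be moved in both directions.\<close>

lemma dual_vertex_tight_span:
  fixes P :: "(real ^ 'n) set"
  assumes P: "P = convex hull V" "finite V" and \<phi>: "\<phi> extreme_point_of dual_polyhedron P"
  shows "span {v \<in> V. blinfun_apply \<phi> v = 1} = span P"
proof (rule ccontr)
  define T where "T = {v \<in> V. blinfun_apply \<phi> v = 1}"
  assume "span {v \<in> V. blinfun_apply \<phi> v = 1} \<noteq> span P"
  moreover have VP: "V \<subseteq> P" by (simp add: P(1) hull_subset)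
  ultimately have "span T \<subset> span P"
    using span_mono[of T P] by (auto simp: T_def)
  then obtain w where w: "w \<noteq> 0" "w \<in> span P" "\<And>y. y \<in> span T \<Longrightarrow> orthogonal w y"
    by (rule orthogonal_to_subspace_exists_gen) blast
  have \<phi>_P: "\<phi> \<in> dual_polyhedron P" using \<phi> by (simp add: extreme_point_of_def)
  \<comment> \<open>Slack at the vertices that are not tight, relative to the effect of moving along
    \<open>w\<close>. The 1 in the denominator avoids division by zero; the element 1 keeps the set
    nonempty.\<close>
  define A where "A = insert 1 ((\<lambda>v. (1 - blinfun_apply \<phi> v) / (1 + \<bar>v \<bullet> w\<bar>)) ` (V - T))"
  define e where "e = Min A"
  have A: "finite A" "A \<noteq> {}" using P(2) by (auto simp: A_def)
  have lt: "blinfun_apply \<phi> v < 1" if "v \<in> V - T" for v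
    using \<phi>_P that VP by (force simp: dual_polyhedron_def T_def)
  have "0 < e" unfolding e_def using A lt by (subst Min_gr_iff) (auto simp: A_def intro!: divide_pos_pos)
  have slack: "e * \<bar>v \<bullet> w\<bar> \<le> 1 - blinfun_apply \<phi> v" if "v \<in> V" for v
  proof (cases "v \<in> T")
    case True
    then have "v \<bullet> w = 0" using w(3)[of v] by (simp add: span_base orthogonal_def inner_commute)
    then show ?thesis using True by (simp add: T_def)
  next
    case False
    then have "e \<le> (1 - blinfun_apply \<phi> v) / (1 + \<bar>v \<bullet> w\<bar>)"
      unfolding e_def using A that by (intro Min_le) (auto simp: A_def)
    then have "e * (1 + \<bar>v \<bullet> w\<bar>) \<le> 1 - blinfun_apply \<phi> v" by (simp add: pos_le_divide_eq)
    then show ?thesis using \<open>0 < e\<close> by (simp add: algebra_simps)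
  qed
  define \<psi> where "\<psi> = blinfun_inner_left w"
  have in_dual: "\<phi> + t *\<^sub>R \<psi> \<in> dual_polyhedron P" if t: "\<bar>t\<bar> = e" for t
    unfolding dual_polyhedron_def
  proof (intro CollectI conjI ballI)
    have "\<phi> \<in> dual_space (span P)" "\<psi> \<in> dual_space (span P)"
      using \<phi>_P inner_in_dual_space[OF w(2)] by (auto simp: dual_polyhedron_def \<psi>_def)
    then show "\<phi> + t *\<^sub>R \<psi> \<in> dual_space (span P)"
      by (auto simp: dual_space_def blinfun.add_left blinfun.scaleR_left)
    have "convex {p. blinfun_apply (\<phi> + t *\<^sub>R \<psi>) p \<le> 1}"
      by (intro convexI) (auto simp: blinfun.add_right blinfun.scaleR_right intro!: convex_bound_le)
    moreover have "V \<subseteq> {p. blinfun_apply (\<phi> + t *\<^sub>R \<psi>) p \<le> 1}"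
    proof
      fix v assume "v \<in> V"
      have "t * (v \<bullet> w) \<le> e * \<bar>v \<bullet> w\<bar>" using t by (metis abs_ge_self abs_mult)
      then show "v \<in> {p. blinfun_apply (\<phi> + t *\<^sub>R \<psi>) p \<le> 1}"
        using slack[OF \<open>v \<in> V\<close>] by (simp add: \<psi>_def blinfun.add_left blinfun.scaleR_left)
    qed
    ultimately show "blinfun_apply (\<phi> + t *\<^sub>R \<psi>) p \<le> 1" if "p \<in> P" for p
      using that hull_minimal[of V _ convex] unfolding P(1) by blast
  qed
  have "blinfun_apply \<psi> w \<noteq> 0" using w(1) by (simp add: \<psi>_def)
  then have "blinfun_apply (\<phi> + (- e) *\<^sub>R \<psi>) w \<noteq> blinfun_apply (\<phi> + e *\<^sub>R \<psi>) w"
    using \<open>0 < e\<close> by (simp add: blinfun.add_left blinfun.scaleR_left blinfun.diff_left)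
  then have ne: "\<phi> + (- e) *\<^sub>R \<psi> \<noteq> \<phi> + e *\<^sub>R \<psi>" by metis
  have "\<phi> = (1 - 1/2) *\<^sub>R (\<phi> + (- e) *\<^sub>R \<psi>) + (1/2) *\<^sub>R (\<phi> + e *\<^sub>R \<psi>)"
    by (simp add: algebra_simps flip: scaleR_add_left)
  then have "\<phi> \<in> open_segment (\<phi> + (- e) *\<^sub>R \<psi>) (\<phi> + e *\<^sub>R \<psi>)"
    unfolding in_segment using ne by (intro conjI exI[of _ "1/2"]) auto
  moreover have "\<phi> + (- e) *\<^sub>R \<psi> \<in> dual_polyhedron P" "\<phi> + e *\<^sub>R \<psi> \<in> dual_polyhedron P"
    using in_dual[of "- e"] in_dual[of e] \<open>0 < e\<close> by auto
  ultimately show False using \<phi> unfolding extreme_point_of_def by blast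
qed

text \<open>For the direction from gauges to the dual, a vertex of the dual agrees with the gauge on
  the cone over its tight vertices. Every lattice point of the span is a difference of two lattice
  points of this cone, so integrality extends from the cone to the span.\<close>

lemma dual_is_lattice_polyhedron_iff:
  fixes P :: "(real ^ 'n) set"
  assumes R: "rational_polytope P" and zero: "0 \<in> P"
  shows "dual_is_lattice_polyhedron P \<longleftrightarrow> (\<forall>x\<in>lattice_cone P. minkowski_gauge P x \<in> \<int>)"
proof
  have P: "polytope P" using R by (simp add: rational_polytope_def)
  have P': "compact P" "convex P" "0 \<in> P"
    using P zero by (auto simp: polytope_imp_compact polytope_imp_convex)
  {
    assume dual: "dual_is_lattice_polyhedron P"
    show "\<forall>x\<in>lattice_cone P. minkowski_gauge P x \<in> \<int>"
    proof
      fix x assume x: "x \<in> lattice_cone P"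
      then obtain c where c: "0 \<le> c" "x \<in> (*\<^sub>R) c ` P" by (auto simp: lattice_cone_def)
      show "minkowski_gauge P x \<in> \<int>"
      proof (cases "x = 0")
        case True
        then have "x \<in> (*\<^sub>R) 0 ` P" using zero by auto
        then have "minkowski_gauge P x = 0"
          using minkowski_gauge_le_iff[OF P' c, of 0] minkowski_gauge_nonneg[OF P' c] by simp
        then show ?thesis by simp
      next
        case False
        then obtain \<phi> where \<phi>: "\<phi> extreme_point_of dual_polyhedron P"
          "blinfun_apply \<phi> x = minkowski_gauge P x"
          using minkowski_gauge_eq_dual_vertex[OF P zero c] by blast
        obtain p where "p \<in> P" "x = c *\<^sub>R p" using c(2) by blast
        then have "x \<in> span P \<inter> int_lattice"
          using x by (simp add: lattice_cone_def span_scale span_base)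
        then show ?thesis using dual \<phi> unfolding dual_is_lattice_polyhedron_def by metis
      qed
    qed
  }
  assume int: "\<forall>x\<in>lattice_cone P. minkowski_gauge P x \<in> \<int>"
  define V where "V = {v. v extreme_point_of P}"
  have conv: "P = convex hull V"
    unfolding V_def using P' by (intro Krein_Milman_Minkowski)
  have "finite V"
    using finite_polyhedron_extreme_points[OF polytope_imp_polyhedron[OF P]] by (simp add: V_def)
  have "V \<subseteq> P" by (auto simp: V_def extreme_point_of_def)
  let ?D = "denominator P"
  have D: "real ?D *\<^sub>R v \<in> int_lattice" if "v \<in> V" for v
    using that denominator_lattice[OF R] lattice_polytope_scaled_iff[OF P denominator_pos[OF R]]
    unfolding V_def by blast
  show "dual_is_lattice_polyhedron P"
    unfolding dual_is_lattice_polyhedron_def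
  proof (intro allI impI ballI)
    fix \<phi> a
    assume \<phi>: "\<phi> extreme_point_of dual_polyhedron P" and a: "a \<in> span P \<inter> int_lattice"
    define T where "T = {v \<in> V. blinfun_apply \<phi> v = 1}"
    have spanT: "span T = span P"
      unfolding T_def by (rule dual_vertex_tight_span[OF conv \<open>finite V\<close> \<phi>])
    have T: "finite T" "T \<subseteq> P" using \<open>finite V\<close> \<open>V \<subseteq> P\<close> by (auto simp: T_def)
    have le: "blinfun_apply \<phi> p \<le> 1" if "p \<in> P" for p
      using \<phi> that by (simp add: extreme_point_of_def dual_polyhedron_def)
    \<comment> \<open>Here \<open>\<phi>\<close> and the gauge both equal the sum of the
      coefficients: \<open>\<phi> \<le> 1\<close> on \<open>P\<close> bounds the gauge from below,
      the representation bounds it from above.\<close>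
    have key: "blinfun_apply \<phi> (\<Sum>v\<in>T. c v *\<^sub>R v) \<in> \<int>"
      if c: "\<And>v. v \<in> T \<Longrightarrow> 0 \<le> c v" and lat: "(\<Sum>v\<in>T. c v *\<^sub>R v) \<in> int_lattice" for c
    proof -
      define x where "x = (\<Sum>v\<in>T. c v *\<^sub>R v)"
      have x: "0 \<le> sum c T" "x \<in> (*\<^sub>R) (sum c T) ` P"
        unfolding x_def using scaleR_image_sum[OF P'(2) _ T, of c] c P'(3) by (auto simp: sum_nonneg)
      have \<phi>x: "blinfun_apply \<phi> x = sum c T"
        by (simp add: x_def T_def blinfun.sum_right blinfun.scaleR_right)
      note g = minkowski_gauge_nonneg[OF P' x] minkowski_gauge_attained[OF P' x]
      obtain p where p: "p \<in> P" "x = minkowski_gauge P x *\<^sub>R p" using g(2) by blast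
      have "blinfun_apply \<phi> x = minkowski_gauge P x * blinfun_apply \<phi> p"
        by (subst p(2)) (simp add: blinfun.scaleR_right)
      also have "\<dots> \<le> minkowski_gauge P x" using g(1) le[OF p(1)] by (simp add: mult_left_le)
      finally have "sum c T \<le> minkowski_gauge P x" using \<phi>x by simp
      moreover have "minkowski_gauge P x \<le> sum c T"
        using minkowski_gauge_le_iff[OF P' x x(1)] x(2) by simp
      ultimately have "minkowski_gauge P x = blinfun_apply \<phi> x" using \<phi>x by linarith
      moreover have "x \<in> lattice_cone P" using x lat unfolding lattice_cone_def x_def by blast
      then have "minkowski_gauge P x \<in> \<int>" using int by blast
      ultimately show ?thesis by (simp only: x_def)
    qed
    obtain u where u: "a = (\<Sum>v\<in>T. u v *\<^sub>R v)"
      using a spanT span_finite[OF T(1)] by auto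
    obtain m :: nat where m: "(\<Sum>v\<in>T. \<bar>u v\<bar>) \<le> real m" using real_arch_simple by blast
    \<comment> \<open>The factor \<open>denominator P\<close> makes \<open>y\<close> a lattice
      point, and \<open>m\<close> outweighs every negative coefficient of \<open>a\<close>.\<close>
    define y where "y = (\<Sum>v\<in>T. real (m * ?D) *\<^sub>R v)"
    have "real m *\<^sub>R real ?D *\<^sub>R v \<in> int_lattice" if "v \<in> T" for v
      using that by (intro int_lattice_of_nat[OF D]) (simp add: T_def)
    then have y: "y \<in> int_lattice" unfolding y_def by (intro int_lattice_sum) simp
    have ay: "a + y = (\<Sum>v\<in>T. (u v + real (m * ?D)) *\<^sub>R v)"
      by (simp add: u y_def sum.distrib scaleR_add_left)
    have nonneg: "0 \<le> u v + real (m * ?D)" if "v \<in> T" for v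
    proof -
      have "\<bar>u v\<bar> \<le> (\<Sum>v\<in>T. \<bar>u v\<bar>)" using T(1) that by (intro member_le_sum) auto
      moreover have "m \<le> m * ?D" using denominator_pos[OF R] by simp
      then have "real m \<le> real (m * ?D)" by (simp only: of_nat_le_iff)
      ultimately show ?thesis using m by linarith
    qed
    have "a + y \<in> int_lattice" using a y by (simp add: int_lattice_add)
    then have "blinfun_apply \<phi> (a + y) \<in> \<int>"
      unfolding ay by (intro key nonneg)
    moreover have "blinfun_apply \<phi> y \<in> \<int>"
      using y unfolding y_def by (intro key) auto
    ultimately have "blinfun_apply \<phi> (a + y) - blinfun_apply \<phi> y \<in> \<int>" by (rule Ints_diff)
    then show "blinfun_apply \<phi> a \<in> \<int>" by (simp add: blinfun.add_right)
  qed
qed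

section \<open>Counting lattice points of the free sum\<close>

text \<open>If the fractional part exceeds one half, each further multiple lowers it by
  \<open>e < 1 / 2\<close> until it would wrap around. The first \<open>m\<close> with
  \<open>m * e \<ge> 1 / 2\<close> still has \<open>m * e < 1\<close>, so the value lands in the
  required interval instead of jumping over it.\<close>

lemma multiple_with_small_frac:
  fixes \<alpha> :: real
  assumes "\<alpha> \<notin> \<int>"
  shows "\<exists>m>0. 0 < frac (real m * \<alpha>) \<and> frac (real m * \<alpha>) \<le> 1 / 2"
proof (cases "frac \<alpha> \<le> 1 / 2")
  case True
  then show ?thesis using assms by (intro exI[of _ 1]) (simp add: frac_gt_0_iff)
next
  case False
  define e where "e = 1 - frac \<alpha>"
  have e: "0 < e" "e < 1 / 2" using False frac_lt_1[of \<alpha>] by (auto simp: e_def)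
  define m where "m = nat \<lceil>1 / (2 * e)\<rceil>"
  have pos: "0 < 1 / (2 * e)" using e by simp
  have "1 / (2 * e) \<le> real m" "real m < 1 / (2 * e) + 1"
    using pos unfolding m_def by linarith+
  then have m: "1 / 2 \<le> real m * e" "real m * e < 1 / 2 + e"
    using e(1) by (simp_all add: field_simps)
  have "real m * \<alpha> - (1 - real m * e) = of_int (int m * (\<lfloor>\<alpha>\<rfloor> + 1) - 1)"
    by (simp add: e_def frac_def algebra_simps)
  then have "frac (real m * \<alpha>) = 1 - real m * e"
    using m e by (subst frac_unique_iff) (auto simp del: of_int_diff of_int_mult)
  moreover have "m > 0" using pos by (simp add: m_def)
  ultimately show ?thesis using m e by (intro exI[of _ m]) auto
qed

lemma lattice_cone_scale:
  assumes "x \<in> lattice_cone P"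
  shows "real m *\<^sub>R x \<in> lattice_cone P"
proof -
  obtain c p where "0 \<le> c" "p \<in> P" "x = c *\<^sub>R p" "x \<in> int_lattice"
    using assms by (auto simp: lattice_cone_def)
  then have "0 \<le> real m * c" "real m *\<^sub>R x = (real m * c) *\<^sub>R p" by auto
  moreover have "real m *\<^sub>R x \<in> int_lattice" using \<open>x \<in> int_lattice\<close> by (rule int_lattice_of_nat)
  ultimately show ?thesis using \<open>p \<in> P\<close> unfolding lattice_cone_def by blast
qed

lemma scaled_lattice_points:
  fixes P :: "(real ^ 'n) set"
  assumes "compact P" "convex P" "0 \<in> P"
  shows "(*\<^sub>R) (real k) ` P \<inter> int_lattice = {x \<in> lattice_cone P. minkowski_gauge P x \<le> real k}"
proof -
  have "x \<in> (*\<^sub>R) (real k) ` P \<longleftrightarrow> minkowski_gauge P x \<le> real k"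
    if "0 \<le> c" "x \<in> (*\<^sub>R) c ` P" for x c
    using minkowski_gauge_le_iff[OF assms that, of "real k"] by simp
  moreover have "x \<in> lattice_cone P" if "x \<in> (*\<^sub>R) (real k) ` P" "x \<in> int_lattice" for x
    using that unfolding lattice_cone_def by (intro CollectI conjI exI[of _ "real k"]) auto
  ultimately show ?thesis unfolding lattice_cone_def by blast
qed

text \<open>The factor \<open>1 - fps_X\<close> turns the counts of \<open>c x \<le> i\<close> into
  counts of \<open>c x = i\<close>; the convolution then sorts the pairs by the exact value of
  \<open>c x\<close>.\<close>

lemma card_sublevel_convolution:
  fixes c :: "'a \<Rightarrow> nat" and d :: "'b \<Rightarrow> nat"
  assumes fin: "\<And>k. finite {x \<in> A. c x \<le> k}" "\<And>k. finite {y \<in> B. d y \<le> k}"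
  shows "real (card {(x, y). x \<in> A \<and> y \<in> B \<and> c x + d y \<le> k}) =
    fps_nth ((1 - fps_X) * Abs_fps (\<lambda>k. real (card {x \<in> A. c x \<le> k}))
      * Abs_fps (\<lambda>k. real (card {y \<in> B. d y \<le> k}))) k"
proof -
  define S where "S i = {x \<in> A. c x = i}" for i
  define T where "T j = {y \<in> B. d y \<le> j}" for j
  have fS: "finite (S i)" for i by (rule finite_subset[OF _ fin(1)[of i]]) (auto simp: S_def)
  have fT: "finite (T j)" for j using fin(2) by (simp add: T_def)
  have diff: "fps_nth ((1 - fps_X) * Abs_fps (\<lambda>k. real (card {x \<in> A. c x \<le> k}))) i = real (card (S i))" for i
  proof (cases i)
    case 0
    then show ?thesis by (simp add: S_def algebra_simps)
  next
    case (Suc j)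
    have "{x \<in> A. c x \<le> Suc j} = {x \<in> A. c x \<le> j} \<union> S (Suc j)" by (auto simp: S_def)
    then have "card {x \<in> A. c x \<le> Suc j} = card {x \<in> A. c x \<le> j} + card (S (Suc j))"
      using fin(1) fS by (simp add: card_Un_disjoint S_def disjoint_iff)
    then show ?thesis using Suc by (simp add: left_diff_distrib)
  qed
  have "{(x, y). x \<in> A \<and> y \<in> B \<and> c x + d y \<le> k} = (\<Union>i\<in>{0..k}. S i \<times> T (k - i))"
    by (auto simp: S_def T_def)
  also have "card \<dots> = (\<Sum>i=0..k. card (S i \<times> T (k - i)))"
    using fS fT by (intro card_UN_disjoint) (auto simp: S_def)
  finally show ?thesis
    unfolding fps_mult_nth[of "(1 - fps_X) * _"] diff by (simp add: card_cartesian_product T_def)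
qed

context free_sum
begin

lemma swap_projection: "free_sum Q P (\<lambda>z. z - \<pi> z)"
proof (rule free_sum.intro)
  show "linear (\<lambda>z. z - \<pi> z)" using lin by (intro linear_compose_sub) (auto simp: linear_iff)
qed (use rat_P rat_Q zero_P zero_Q int on_P on_Q in \<open>auto simp: int_lattice_diff\<close>)

text \<open>Vertices of the sum are vertices of a summand, and vertices of a summand are projections
  of vertices of the sum. Hence a positive multiple clears the sum iff it clears both
  summands.\<close>

lemma denominator_conv_union:
  "denominator (conv_union P Q) = lcm (denominator P) (denominator Q)"
proof -
  interpret swap: free_sum Q P "\<lambda>z. z - \<pi> z" by (rule swap_projection)
  have comm: "conv_union Q P = conv_union P Q" by (simp add: conv_union_def Un_commute)
  have iff: "denominator (conv_union P Q) dvd d \<longleftrightarrow> denominator P dvd d \<and> denominator Q dvd d"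
    if "0 < d" for d
  proof -
    have "lattice_polytope ((*\<^sub>R) (real d) ` conv_union P Q) \<longleftrightarrow>
        lattice_polytope ((*\<^sub>R) (real d) ` P) \<and> lattice_polytope ((*\<^sub>R) (real d) ` Q)" (is "?L \<longleftrightarrow> ?R")
    proof
      assume ?L
      then show ?R
        using lattice_scaled_conv_union_imp[OF that] swap.lattice_scaled_conv_union_imp[OF that] comm
        by simp
    next
      assume ?R
      then show ?L
        unfolding lattice_polytope_scaled_iff[OF polytope_conv_union that]
          lattice_polytope_scaled_iff[OF poly_P that] lattice_polytope_scaled_iff[OF poly_Q that]
        using extreme_point_of_conv_union by blast
    qed
    then show ?thesis
      using denominator_dvd_iff[OF rational_conv_union that] denominator_dvd_iff[OF rat_P that]
        denominator_dvd_iff[OF rat_Q that] by simp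
  qed
  have pos: "0 < lcm (denominator P) (denominator Q)"
    using denominator_pos[OF rat_P] denominator_pos[OF rat_Q] by (simp add: lcm_pos_nat)
  show ?thesis
    using iff[OF pos] iff[OF denominator_pos[OF rational_conv_union]]
    by (intro dvd_antisym) auto
qed

lemmas cpt_P = polytope_imp_compact[OF poly_P] and cpt_Q = polytope_imp_compact[OF poly_Q]

lemma finite_lattice_points:
  "finite ((*\<^sub>R) (real k) ` conv_union P Q \<inter> int_lattice)"
  "finite ((*\<^sub>R) (real k) ` P \<inter> int_lattice)" "finite ((*\<^sub>R) (real k) ` Q \<inter> int_lattice)"
  using polytope_imp_bounded[OF polytope_conv_union] polytope_imp_bounded[OF poly_P]
    polytope_imp_bounded[OF poly_Q]
  by (auto intro!: finite_bounded_Int_int_lattice bounded_scaling)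

lemma span_scaled_P: "x \<in> (*\<^sub>R) a ` P \<Longrightarrow> \<pi> x = x"
  and span_scaled_Q: "y \<in> (*\<^sub>R) b ` Q \<Longrightarrow> \<pi> y = 0"
  using on_P on_Q by (auto simp: span_scale span_base)

definition sum_pairs :: "nat \<Rightarrow> ((real ^ 'n) \<times> (real ^ 'n)) set" where
  "sum_pairs k = {(x, y). x \<in> lattice_cone P \<and> y \<in> lattice_cone Q \<and>
     minkowski_gauge P x + minkowski_gauge Q y \<le> real k}"

lemma bij_betw_sum_pairs:
  "bij_betw (\<lambda>(x, y). x + y) (sum_pairs k) ((*\<^sub>R) (real k) ` conv_union P Q \<inter> int_lattice)"
proof (rule bij_betw_imageI)
  have proj: "\<pi> x = x" "\<pi> y = 0" if "(x, y) \<in> sum_pairs k" for x y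
    using that span_scaled_P span_scaled_Q unfolding sum_pairs_def lattice_cone_def by blast+
  show "inj_on (\<lambda>(x, y). x + y) (sum_pairs k)"
  proof (rule inj_onI, clarify)
    fix x y x' y' assume *: "(x, y) \<in> sum_pairs k" "(x', y') \<in> sum_pairs k" "x + y = x' + y'"
    have "\<pi> (x + y) = x" "\<pi> (x' + y') = x'"
      using proj[OF *(1)] proj[OF *(2)] by (simp_all add: linear_add[OF lin])
    then show "x = x' \<and> y = y'" using *(3) by auto
  qed
  show "(\<lambda>(x, y). x + y) ` sum_pairs k = (*\<^sub>R) (real k) ` conv_union P Q \<inter> int_lattice"
  proof (intro equalityI subsetI)
    fix z assume "z \<in> (\<lambda>(x, y). x + y) ` sum_pairs k"
    then obtain x y where z: "z = x + y" and x: "x \<in> lattice_cone P" and y: "y \<in> lattice_cone Q"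
      and le: "minkowski_gauge P x + minkowski_gauge Q y \<le> real k"
      by (auto simp: sum_pairs_def)
    obtain a where a: "0 \<le> a" "x \<in> (*\<^sub>R) a ` P" using x by (auto simp: lattice_cone_def)
    obtain b where b: "0 \<le> b" "y \<in> (*\<^sub>R) b ` Q" using y by (auto simp: lattice_cone_def)
    note g = minkowski_gauge_nonneg[OF cpt_P conv_P zero_P a]
      minkowski_gauge_attained[OF cpt_P conv_P zero_P a] minkowski_gauge_nonneg[OF cpt_Q conv_Q zero_Q b]
    \<comment> \<open>All of the slack goes to \<open>Q\<close>, because the two factors have to add
      up to exactly \<open>k\<close>.\<close>
    have "y \<in> (*\<^sub>R) (real k - minkowski_gauge P x) ` Q"
      using minkowski_gauge_le_iff[OF cpt_Q conv_Q zero_Q b, of "real k - minkowski_gauge P x"] le g(3)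
      by auto
    then have "\<exists>a b x' y'. 0 \<le> a \<and> 0 \<le> b \<and> a + b = real k \<and>
        x' \<in> (*\<^sub>R) a ` P \<and> y' \<in> (*\<^sub>R) b ` Q \<and> z = x' + y'"
      using z g le
      by (intro exI[of _ "minkowski_gauge P x"] exI[of _ "real k - minkowski_gauge P x"]
          exI[of _ x] exI[of _ y]) auto
    then have "z \<in> (*\<^sub>R) (real k) ` conv_union P Q"
      using scaleR_conv_union_iff[of P Q "real k" z] conv_P conv_Q zero_P zero_Q by auto
    moreover have "z \<in> int_lattice"
      using x y z by (simp add: lattice_cone_def int_lattice_add)
    ultimately show "z \<in> (*\<^sub>R) (real k) ` conv_union P Q \<inter> int_lattice" by blast
  next
    fix z assume z: "z \<in> (*\<^sub>R) (real k) ` conv_union P Q \<inter> int_lattice"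
    have ne: "P \<noteq> {}" "Q \<noteq> {}" using zero_P zero_Q by auto
    from z have "z \<in> (*\<^sub>R) (real k) ` conv_union P Q" by blast
    then obtain a b x y where ab: "0 \<le> a" "0 \<le> b" "a + b = real k"
      and x: "x \<in> (*\<^sub>R) a ` P" and y: "y \<in> (*\<^sub>R) b ` Q" and zxy: "z = x + y"
      unfolding scaleR_conv_union_iff[OF conv_P ne(1) conv_Q ne(2) of_nat_0_le_iff] by blast
    have "\<pi> z = x" using span_scaled_P[OF x] span_scaled_Q[OF y] by (simp add: zxy linear_add[OF lin])
    then have "x \<in> int_lattice" using int z by auto
    moreover have "y \<in> int_lattice" using int_lattice_diff[of z x] z \<open>x \<in> int_lattice\<close> by (auto simp: zxy)
    moreover have "minkowski_gauge P x \<le> a" "minkowski_gauge Q y \<le> b"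
      using minkowski_gauge_le_iff[OF cpt_P conv_P zero_P ab(1) x ab(1)] x
        minkowski_gauge_le_iff[OF cpt_Q conv_Q zero_Q ab(2) y ab(2)] y by auto
    ultimately have "(x, y) \<in> sum_pairs k"
      using x y ab unfolding sum_pairs_def lattice_cone_def by auto
    then show "z \<in> (\<lambda>(x, y). x + y) ` sum_pairs k" using zxy by force
  qed
qed

lemma ehrhart_conv_union_nth: "fps_nth (ehrhart_series (conv_union P Q)) k = real (card (sum_pairs k))"
proof -
  have "conv_union P Q \<noteq> {}" using subset_conv_union zero_P by blast
  then show ?thesis using bij_betw_same_card[OF bij_betw_sum_pairs[of k]] by (simp add: ehrhart_series_eq)
qed

lemma finite_sum_pairs: "finite (sum_pairs k)"
  using bij_betw_finite[OF bij_betw_sum_pairs] finite_lattice_points(1) by blast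

definition ceil_pairs :: "nat \<Rightarrow> ((real ^ 'n) \<times> (real ^ 'n)) set" where
  "ceil_pairs k = {(x, y). x \<in> lattice_cone P \<and> y \<in> lattice_cone Q \<and>
     nat \<lceil>minkowski_gauge P x\<rceil> + nat \<lceil>minkowski_gauge Q y\<rceil> \<le> k}"

lemma lattice_cone_gauge_nonneg:
  "x \<in> lattice_cone P \<Longrightarrow> 0 \<le> minkowski_gauge P x" "y \<in> lattice_cone Q \<Longrightarrow> 0 \<le> minkowski_gauge Q y"
  using minkowski_gauge_nonneg[OF cpt_P conv_P zero_P] minkowski_gauge_nonneg[OF cpt_Q conv_Q zero_Q]
  unfolding lattice_cone_def by blast+

lemma ehrhart_product_nth:
  "fps_nth ((1 - fps_X) * ehrhart_series P * ehrhart_series Q) k = real (card (ceil_pairs k))"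
proof -
  have iff: "nat \<lceil>r\<rceil> \<le> j \<longleftrightarrow> r \<le> real j" for r j by linarith
  have P: "{x \<in> lattice_cone P. nat \<lceil>minkowski_gauge P x\<rceil> \<le> j} = (*\<^sub>R) (real j) ` P \<inter> int_lattice"
    and Q: "{y \<in> lattice_cone Q. nat \<lceil>minkowski_gauge Q y\<rceil> \<le> j} = (*\<^sub>R) (real j) ` Q \<inter> int_lattice" for j
    by (simp_all only: iff scaled_lattice_points[OF cpt_P conv_P zero_P]
        scaled_lattice_points[OF cpt_Q conv_Q zero_Q])
  have E: "ehrhart_series P = Abs_fps (\<lambda>k. real (card {x \<in> lattice_cone P. nat \<lceil>minkowski_gauge P x\<rceil> \<le> k}))"
    "ehrhart_series Q = Abs_fps (\<lambda>k. real (card {y \<in> lattice_cone Q. nat \<lceil>minkowski_gauge Q y\<rceil> \<le> k}))"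
    unfolding P Q using zero_P zero_Q by (auto intro!: ehrhart_series_eq)
  show ?thesis unfolding E ceil_pairs_def
    by (rule card_sublevel_convolution[symmetric]) (simp_all only: P Q finite_lattice_points)
qed

lemma ceil_pairs_subset: "ceil_pairs k \<subseteq> sum_pairs k"
proof -
  have "r + s \<le> real k" if "nat \<lceil>r\<rceil> + nat \<lceil>s\<rceil> \<le> k" for r s :: real using that by linarith
  then show ?thesis unfolding ceil_pairs_def sum_pairs_def by blast
qed

text \<open>Rounding up each summand can only exclude pairs, so one finite set contains the other,
  and equal counts mean equal sets.\<close>

lemma ehrhart_eq_iff_pairs:
  "ehrhart_series (conv_union P Q) = (1 - fps_X) * ehrhart_series P * ehrhart_series Q \<longleftrightarrow>
   (\<forall>k. sum_pairs k \<subseteq> ceil_pairs k)"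
proof -
  have "card (sum_pairs k) = card (ceil_pairs k) \<longleftrightarrow> sum_pairs k \<subseteq> ceil_pairs k" for k
    using card_subset_eq[OF finite_sum_pairs ceil_pairs_subset, of k] ceil_pairs_subset[of k] by auto
  then show ?thesis by (simp add: fps_eq_iff ehrhart_conv_union_nth ehrhart_product_nth)
qed

text \<open>If both gauges take nonintegral values at lattice points, then at suitable multiples both
  fractional parts are at most one half, and rounding up the sum loses against rounding up the summands.\<close>

lemma ehrhart_eq_iff_gauge_integral:
  "ehrhart_series (conv_union P Q) = (1 - fps_X) * ehrhart_series P * ehrhart_series Q \<longleftrightarrow>
   (\<forall>x\<in>lattice_cone P. minkowski_gauge P x \<in> \<int>) \<or> (\<forall>y\<in>lattice_cone Q. minkowski_gauge Q y \<in> \<int>)"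
  unfolding ehrhart_eq_iff_pairs
proof (intro iffI allI)
  assume eq: "\<forall>k. sum_pairs k \<subseteq> ceil_pairs k"
  show "(\<forall>x\<in>lattice_cone P. minkowski_gauge P x \<in> \<int>) \<or> (\<forall>y\<in>lattice_cone Q. minkowski_gauge Q y \<in> \<int>)"
  proof (rule ccontr)
    assume "\<not> ?thesis"
    then obtain x y where x: "x \<in> lattice_cone P" "minkowski_gauge P x \<notin> \<int>"
      and y: "y \<in> lattice_cone Q" "minkowski_gauge Q y \<notin> \<int>" by blast
    obtain m where m: "m > 0" "0 < frac (real m * minkowski_gauge P x)"
      "frac (real m * minkowski_gauge P x) \<le> 1 / 2" using multiple_with_small_frac[OF x(2)] by blast
    obtain n where n: "n > 0" "0 < frac (real n * minkowski_gauge Q y)"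
      "frac (real n * minkowski_gauge Q y) \<le> 1 / 2" using multiple_with_small_frac[OF y(2)] by blast
    define r where "r = real m * minkowski_gauge P x"
    define s where "s = real n * minkowski_gauge Q y"
    have r: "minkowski_gauge P (real m *\<^sub>R x) = r"
      using x(1) m(1) minkowski_gauge_scaleR[OF cpt_P conv_P zero_P, of _ x "real m"]
      by (auto simp: lattice_cone_def r_def)
    have s: "minkowski_gauge Q (real n *\<^sub>R y) = s"
      using y(1) n(1) minkowski_gauge_scaleR[OF cpt_Q conv_Q zero_Q, of _ y "real n"]
      by (auto simp: lattice_cone_def s_def)
    have nonneg: "0 \<le> r" "0 \<le> s"
      using lattice_cone_gauge_nonneg x(1) y(1) by (auto simp: r_def s_def)
    \<comment> \<open>The fractional parts add up to at most 1, so \<open>r + s \<le> k\<close>, but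
      the two ceilings add up to \<open>k + 1\<close>.\<close>
    define k where "k = nat (\<lfloor>r\<rfloor> + \<lfloor>s\<rfloor> + 1)"
    have fr: "real_of_int \<lfloor>r\<rfloor> < r" "r \<le> real_of_int \<lfloor>r\<rfloor> + 1 / 2"
      "real_of_int \<lfloor>s\<rfloor> < s" "s \<le> real_of_int \<lfloor>s\<rfloor> + 1 / 2"
      using m n by (simp_all add: r_def s_def frac_def)
    have "r + s \<le> real k" using fr nonneg by (simp add: k_def)
    then have "(real m *\<^sub>R x, real n *\<^sub>R y) \<in> sum_pairs k"
      using x(1) y(1) r s by (simp add: sum_pairs_def lattice_cone_scale)
    then have "(real m *\<^sub>R x, real n *\<^sub>R y) \<in> ceil_pairs k" using eq by blast
    then have "nat \<lceil>r\<rceil> + nat \<lceil>s\<rceil> \<le> k" using r s by (simp add: ceil_pairs_def)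
    moreover have "\<lceil>r\<rceil> = \<lfloor>r\<rfloor> + 1" "\<lceil>s\<rceil> = \<lfloor>s\<rfloor> + 1" using fr by linarith+
    moreover have "0 \<le> \<lfloor>r\<rfloor>" "0 \<le> \<lfloor>s\<rfloor>" using nonneg by simp_all
    ultimately show False unfolding k_def by linarith
  qed
next
  fix k
  assume int: "(\<forall>x\<in>lattice_cone P. minkowski_gauge P x \<in> \<int>) \<or> (\<forall>y\<in>lattice_cone Q. minkowski_gauge Q y \<in> \<int>)"
  \<comment> \<open>An integral summand can be moved out of the ceiling of the sum.\<close>
  have ceil: "nat \<lceil>r\<rceil> + nat \<lceil>s\<rceil> \<le> k" if "r \<in> \<int>" "0 \<le> r" "0 \<le> s" "r + s \<le> real k" for r s :: real
  proof -
    from \<open>r \<in> \<int>\<close> obtain i where i: "r = of_int i" by (auto elim: Ints_cases)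
    have "\<lceil>s\<rceil> \<le> int k - i" using that(4) i by linarith
    moreover have "0 \<le> i" using that(2) i by simp
    moreover have "0 \<le> \<lceil>s\<rceil>" using that(3) by simp
    ultimately have "nat i + nat \<lceil>s\<rceil> \<le> k" by linarith
    then show ?thesis unfolding i by simp
  qed
  show "sum_pairs k \<subseteq> ceil_pairs k"
  proof clarify
    fix x y assume xy: "(x, y) \<in> sum_pairs k"
    define r s where "r = minkowski_gauge P x" and "s = minkowski_gauge Q y"
    have *: "x \<in> lattice_cone P" "y \<in> lattice_cone Q" "r + s \<le> real k" "0 \<le> r" "0 \<le> s"
      using xy lattice_cone_gauge_nonneg by (auto simp: sum_pairs_def r_def s_def)
    have "r \<in> \<int> \<or> s \<in> \<int>" using int * by (auto simp: r_def s_def)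
    then have "nat \<lceil>r\<rceil> + nat \<lceil>s\<rceil> \<le> k" using ceil[of r s] ceil[of s r] * by (auto simp: add.commute)
    then show "(x, y) \<in> ceil_pairs k" using * by (simp add: ceil_pairs_def r_def s_def)
  qed
qed

text \<open>Supplies the growth bound for the sum: growth exponents add under multiplication, as
  dimensions do under free sums.\<close>

lemma card_conv_union_le:
  "card ((*\<^sub>R) (real k) ` conv_union P Q \<inter> int_lattice) \<le>
   card ((*\<^sub>R) (real k) ` P \<inter> int_lattice) * card ((*\<^sub>R) (real k) ` Q \<inter> int_lattice)"
proof -
  have "sum_pairs k \<subseteq> ((*\<^sub>R) (real k) ` P \<inter> int_lattice) \<times> ((*\<^sub>R) (real k) ` Q \<inter> int_lattice)"
    unfolding scaled_lattice_points[OF cpt_P conv_P zero_P] scaled_lattice_points[OF cpt_Q conv_Q zero_Q]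
    using lattice_cone_gauge_nonneg by (force simp: sum_pairs_def)
  then have "card (sum_pairs k) \<le>
      card (((*\<^sub>R) (real k) ` P \<inter> int_lattice) \<times> ((*\<^sub>R) (real k) ` Q \<inter> int_lattice))"
    using finite_lattice_points by (intro card_mono) auto
  then show ?thesis
    using bij_betw_same_card[OF bij_betw_sum_pairs[of k]] by (simp add: card_cartesian_product)
qed

end

section \<open>From Ehrhart series to delta polynomials\<close>

theorem theorem1p4:
  fixes P Q :: "(real ^ 'n) set"
  assumes "rational_polytope P"
    and "rational_polytope Q"
    and "is_free_sum P Q"
  shows
    "let lattice_dual = (dual_is_lattice_polyhedron P \<or> dual_is_lattice_polyhedron Q);
         ehrhart_eq =
           (ehrhart_series (conv_union P Q) = (1 - fps_X) * ehrhart_series P * ehrhart_series Q);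
         delta_eq =
           (fps_of_poly (delta_poly (conv_union P Q)) =
              ((1 - fps_X) *
                 (1 - fps_X ^ lcm (denominator P) (denominator Q))
                   ^ (nat (aff_dim P) + nat (aff_dim Q) + 1)) /
              ((1 - fps_X ^ denominator P) ^ (nat (aff_dim P) + 1) *
                 (1 - fps_X ^ denominator Q) ^ (nat (aff_dim Q) + 1)) *
              fps_of_poly (delta_poly P) * fps_of_poly (delta_poly Q))
     in (lattice_dual \<longrightarrow> ehrhart_eq \<and> delta_eq) \<and>
        (ehrhart_eq \<or> delta_eq \<longrightarrow> lattice_dual) \<and>
        (lattice_polytope P \<and> lattice_polytope Q \<longrightarrow>
           (delta_poly (conv_union P Q) = delta_poly P * delta_poly Q \<longleftrightarrow> lattice_dual))"
proof -
  have swap: "is_free_sum Q P" using assms(3) by (rule is_free_sum_commute)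
  have zero: "0 \<in> P" "0 \<in> Q" using is_free_sum_zero[OF assms(3)] is_free_sum_zero[OF swap] by auto
  obtain \<pi> where \<pi>: "linear \<pi>" "\<And>z. z \<in> int_lattice \<Longrightarrow> \<pi> z \<in> int_lattice"
    "\<And>x. x \<in> span P \<Longrightarrow> \<pi> x = x" "\<And>y. y \<in> span Q \<Longrightarrow> \<pi> y = 0"
    using is_free_sum_projection[OF assms(3)] by blast
  interpret free_sum P Q \<pi>
    by (rule free_sum.intro[OF assms(1,2) zero \<pi>])
  have bounded: "bounded P" "bounded Q" using poly_P poly_Q by (auto intro: polytope_imp_bounded)
  obtain C where C: "0 \<le> C"
    "\<And>k. real (card ((*\<^sub>R) (real k) ` P \<inter> int_lattice)) \<le> C * real (Suc k) ^ dim P"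
    using is_free_sum_growth[OF assms(3) bounded(1)] by blast
  obtain C' where C': "0 \<le> C'"
    "\<And>k. real (card ((*\<^sub>R) (real k) ` Q \<inter> int_lattice)) \<le> C' * real (Suc k) ^ dim Q"
    using is_free_sum_growth[OF swap bounded(2)] by blast
  define R where "R = conv_union P Q"
  have growth: "real (card ((*\<^sub>R) (real k) ` R \<inter> int_lattice)) \<le> (C * C') * real (Suc k) ^ dim R" for k
  proof -
    have "real (card ((*\<^sub>R) (real k) ` R \<inter> int_lattice)) \<le>
        real (card ((*\<^sub>R) (real k) ` P \<inter> int_lattice)) * real (card ((*\<^sub>R) (real k) ` Q \<inter> int_lattice))"
      using card_conv_union_le[of k] unfolding R_def by (metis of_nat_le_iff of_nat_mult)
    also have "\<dots> \<le> (C * real (Suc k) ^ dim P) * (C' * real (Suc k) ^ dim Q)"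
      using C C' by (intro mult_mono) auto
    also have "\<dots> = (C * C') * real (Suc k) ^ dim R"
      unfolding R_def dim_conv_union by (simp only: power_add mult_ac)
    finally show ?thesis .
  qed
  define dP dQ where "dP = denominator P" and "dQ = denominator Q"
  have pos: "0 < dP" "0 < dQ" "0 < lcm dP dQ"
    using denominator_pos[OF assms(1)] denominator_pos[OF assms(2)] by (auto simp: dP_def dQ_def lcm_pos_nat)
  define U where "U = ((1 - fps_X ^ lcm dP dQ) ^ (nat (aff_dim P) + nat (aff_dim Q) + 1) :: real fps)"
  define A where "A = ((1 - fps_X ^ dP) ^ (nat (aff_dim P) + 1) :: real fps)"
  define B where "B = ((1 - fps_X ^ dQ) ^ (nat (aff_dim Q) + 1) :: real fps)"
  have unit: "fps_nth U 0 = 1" "fps_nth A 0 = 1" "fps_nth B 0 = 1"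
    unfolding U_def A_def B_def using pos by (simp_all only: fps_one_minus_X_power_nth_0)
  then have "U \<noteq> 0" by auto
  have delta_P: "fps_of_poly (delta_poly P) = ehrhart_series P * A"
    unfolding A_def dP_def by (rule delta_poly_eq[OF assms(1) zero(1) C])
  have delta_Q: "fps_of_poly (delta_poly Q) = ehrhart_series Q * B"
    unfolding B_def dQ_def by (rule delta_poly_eq[OF assms(2) zero(2) C'])
  have delta_R: "fps_of_poly (delta_poly R) = ehrhart_series R * U"
  proof -
    have "0 \<in> R" using zero subset_conv_union by (auto simp: R_def)
    moreover have "0 \<le> C * C'" using C C' by simp
    ultimately have "fps_of_poly (delta_poly R) =
        ehrhart_series R * (1 - fps_X ^ denominator R) ^ (nat (aff_dim R) + 1)"
      using rational_conv_union growth unfolding R_def by (intro delta_poly_eq)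
    then show ?thesis
      unfolding U_def R_def denominator_conv_union dP_def dQ_def by (simp only: aff_dim_sum)
  qed
  define ehr where "ehr \<longleftrightarrow> ehrhart_series R = (1 - fps_X) * ehrhart_series P * ehrhart_series Q"
  have dual: "ehr \<longleftrightarrow> dual_is_lattice_polyhedron P \<or> dual_is_lattice_polyhedron Q"
    unfolding ehr_def R_def ehrhart_eq_iff_gauge_integral
      dual_is_lattice_polyhedron_iff[OF assms(1) zero(1)]
      dual_is_lattice_polyhedron_iff[OF assms(2) zero(2)] ..
  have AB: "fps_nth (A * B) 0 \<noteq> 0" using unit by simp
  \<comment> \<open>The denominators \<open>A\<close> and \<open>B\<close> cancel against those
    hidden in the delta polynomials. What remains is the product side of the series identity times
    \<open>U\<close>, and \<open>U\<close> can be cancelled because it is nonzero.\<close>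
  have "((1 - fps_X) * U) / (A * B) * fps_of_poly (delta_poly P) * fps_of_poly (delta_poly Q) =
      ((1 - fps_X) * U) * (inverse (A * B) * (A * B)) * (ehrhart_series P * ehrhart_series Q)"
    unfolding delta_P delta_Q fps_divide_unit[OF AB] by (simp only: mult_ac)
  also have "\<dots> = ((1 - fps_X) * ehrhart_series P * ehrhart_series Q) * U"
    unfolding inverse_mult_eq_1[OF AB] by (simp only: mult_ac mult_1_left mult_1_right)
  finally have delta: "fps_of_poly (delta_poly R) =
      ((1 - fps_X) * U) / (A * B) * fps_of_poly (delta_poly P) * fps_of_poly (delta_poly Q) \<longleftrightarrow> ehr"
    unfolding delta_R ehr_def using \<open>U \<noteq> 0\<close> by simp
  have lattice: "delta_poly R = delta_poly P * delta_poly Q \<longleftrightarrow> ehr"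
    if "lattice_polytope P" "lattice_polytope Q"
  proof -
    have "dP = 1" "dQ = 1"
      unfolding dP_def dQ_def using that denominator_lattice_polytope by blast+
    \<comment> \<open>All factors are now powers of \<open>1 - fps_X\<close>, with exponents
      \<open>(dim P + 1) + (dim Q + 1)\<close> on the left and
      \<open>1 + (dim P + dim Q + 1)\<close> on the right, so the prefactor is 1.\<close>
    then have "A * B = (1 - fps_X) * U"
      unfolding A_def B_def U_def by (simp flip: power_add power_Suc)
    then have "fps_of_poly (delta_poly P * delta_poly Q) =
        ((1 - fps_X) * ehrhart_series P * ehrhart_series Q) * U"
      unfolding fps_of_poly_mult delta_P delta_Q by (simp add: mult_ac)
    then have "fps_of_poly (delta_poly R) = fps_of_poly (delta_poly P * delta_poly Q) \<longleftrightarrow> ehr"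
      unfolding delta_R ehr_def using \<open>U \<noteq> 0\<close> by simp
    then show ?thesis by (simp only: fps_of_poly_eq_iff)
  qed
  show ?thesis
    using dual delta lattice
    unfolding Let_def ehr_def R_def U_def A_def B_def dP_def dQ_def by argo
qed

end
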